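(* If $|\mu_0|<\infty$ a.s. and $\mathbb{E}\sigma_0^2\in(0,\infty)$, then for every $x\in\mathbb{R}$, $$\frac{\mathbb{E}_\xi Z_n(-\infty,b_nx+a_n]}{\mathbb{E}_\xi Z_n(\mathbb{R})}\to\Phi(x)\quad\text{a.s.},$$ where $a_n=\sum_{i=0}^{n-1}\mu_i$ and $b_n=\left(\sum_{i=0}^{n-1}\sigma_i^2\right)^{1/2}$.
   Context: Branching random walk in a random environment in time. Let $\xi=(\xi_n)_{n\ge 0}$ be a stationary and ergodic sequence of random variables with values in a measurable space $\Theta$; each realization of $\xi_n$ determines a probability distribution $\eta_n=\eta(\xi_n)$ on $\mathbb{N}\times\mathbb{R}\times\mathbb{R}\times\cdots$. Given $\xi$ (quenched law $\mathbb{P}_\xi$, expectation $\mathbb{E}_\xi$), let $X(u)=(N(u),L_1(u),L_2(u),\dots)$, indexed by finite sequences $u\in\{\emptyset\}\cup\bigcup_{n\ge1}\mathbb{N}^n$, be independent random vectors, $X(u)$ having law $\eta_n$ when the length $|u|$ equals $n$ (values $L_i(u)$ with $i>N(u)$ play no role). The initial particle $\emptyset$ is at $S_\emptyset=0$; each particle $u$ of generation $n$, located at $S_u$, is replaced by $N(u)$ particles $ui$ of generation $n+1$ located at $S_{ui}=S_u+L_i(u)$, $1\le i\le N(u)$. Let $\mathbb{T}_n$ be the set of particles of generation $n$ and $Z_n=\sum_{u\in\mathbb{T}_n}\delta_{S_u}$ their counting measure. The annealed law $\mathbb{P}$ (expectation $\mathbb{E}$) is $\mathbb{P}_\xi$ integrated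 against the law of $\xi$; "a.s." refers to $\mathbb{P}$. Write $N=N(\emptyset)$ and $m_n=\mathbb{E}_\xi N(u)$ for $|u|=n$. Standing assumption: $\mathbb{E}\log m_0\in(0,\infty)$ and $\mathbb{E}\frac{N}{m_0}\log^+N<\infty$. Notation: for $|u|=n$, $\mu_n=\frac1{m_n}\mathbb{E}_\xi\sum_{i=1}^{N(u)}L_i(u)$ and $\sigma_n^2=\frac1{m_n}\mathbb{E}_\xi\sum_{i=1}^{N(u)}(L_i(u)-\mu_n)^2$. $\Phi$ is the distribution function of the standard normal law. *)

theory Defs
  imports "HOL-Probability.Probability"
begin

section \<open>Stationary and ergodic environments\<close>

definition seq_law :: "'w measure \<Rightarrow> 'e measure \<Rightarrow> (nat \<Rightarrow> 'w \<Rightarrow> 'e) \<Rightarrow> (nat \<Rightarrow> 'e) measure" where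
  "seq_law M \<Theta> \<xi> = distr M (\<Pi>\<^sub>M n\<in>UNIV. \<Theta>) (\<lambda>\<omega> n. \<xi> n \<omega>)"

definition stationary_seq :: "'w measure \<Rightarrow> 'e measure \<Rightarrow> (nat \<Rightarrow> 'w \<Rightarrow> 'e) \<Rightarrow> bool" where
  "stationary_seq M \<Theta> \<xi> \<longleftrightarrow> seq_law M \<Theta> (\<lambda>n. \<xi> (Suc n)) = seq_law M \<Theta> \<xi>"

definition ergodic_seq :: "'w measure \<Rightarrow> 'e measure \<Rightarrow> (nat \<Rightarrow> 'w \<Rightarrow> 'e) \<Rightarrow> bool" where
  "ergodic_seq M \<Theta> \<xi> \<longleftrightarrow>
     (\<forall>A \<in> sets (\<Pi>\<^sub>M n\<in>UNIV. \<Theta>).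
        {s \<in> space (\<Pi>\<^sub>M n\<in>UNIV. \<Theta>). (\<lambda>n. s (Suc n)) \<in> A} = A \<longrightarrow>
        measure (seq_law M \<Theta> \<xi>) A = 0 \<or> measure (seq_law M \<Theta> \<xi>) A = 1)"

section \<open>The branching random walk\<close>

text \<open>
  A reproduction vector \<open>(N, L\<^sub>1, L\<^sub>2, \<dots>)\<close> is a pair of \<open>N\<close> and a real sequence. Children are
  numbered from 0: \<open>L\<^sub>i\<close> is entry \<open>i - 1\<close> of the sequence, and \<open>1 \<le> i \<le> N\<close> becomes \<open>i < N\<close>.
  Particles are finite sequences of child numbers, read from the root; a tree configuration
  assigns a reproduction vector \<open>X(u)\<close> to every sequence \<open>u\<close>, present in the process or not.
\<close>

type_synonym rvec = "nat \<times> (nat \<Rightarrow> real)"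
type_synonym config = "nat list \<Rightarrow> rvec"

definition rvec_space :: "rvec measure" where
  "rvec_space = count_space UNIV \<Otimes>\<^sub>M (\<Pi>\<^sub>M i\<in>UNIV. borel)"

definition config_space :: "config measure" where
  "config_space = (\<Pi>\<^sub>M u\<in>UNIV. rvec_space)"

definition offspring :: "config \<Rightarrow> nat list \<Rightarrow> nat" where
  "offspring X u = fst (X u)"

definition displacement :: "config \<Rightarrow> nat list \<Rightarrow> nat \<Rightarrow> real" where
  "displacement X u i = snd (X u) i"

primrec generation :: "config \<Rightarrow> nat \<Rightarrow> nat list set" where
  "generation X 0 = {[]}"
| "generation X (Suc n) = {u @ [i] | u i. u \<in> generation X n \<and> i < offspring X u}"

definition position :: "config \<Rightarrow> nat list \<Rightarrow> real" where
  "position X u = (\<Sum>k<length u. displacement X (take k u) (u ! k))"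

lemma position_Nil: "position X [] = 0"
  by (simp add: position_def)

lemma position_snoc: "position X (u @ [i]) = position X u + displacement X u i"
  by (simp add: position_def nth_append)

text \<open>The image of counting measure under the positions is \<open>\<Sum>u. \<delta>\<^bsub>S u\<^esub>\<close>, with multiplicity.\<close>

definition counting_measure :: "config \<Rightarrow> nat \<Rightarrow> real measure" where
  "counting_measure X n = distr (count_space (generation X n)) borel (position X)"

section \<open>Quenched and annealed laws\<close>

definition quenched :: "('e \<Rightarrow> rvec measure) \<Rightarrow> (nat \<Rightarrow> 'e) \<Rightarrow> config measure" where
  "quenched \<eta> s = (\<Pi>\<^sub>M u\<in>UNIV. \<eta> (s (length u)))"

text \<open>
  The annealed law is the joint law of environment and configuration, where the environment has
  law \<open>\<tau>\<close> and the configuration has conditional law \<open>quenched \<eta> s\<close>.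
\<close>

definition annealed :: "('e \<Rightarrow> rvec measure) \<Rightarrow> (nat \<Rightarrow> 'e) measure \<Rightarrow> ((nat \<Rightarrow> 'e) \<times> config) measure" where
  "annealed \<eta> \<tau> = \<tau> \<bind> (\<lambda>s. distr (quenched \<eta> s) (\<tau> \<Otimes>\<^sub>M config_space) (\<lambda>X. (s, X)))"

lemma prob_space_rvec_law:
  assumes "\<eta> \<in> \<Theta> \<rightarrow>\<^sub>M prob_algebra rvec_space" "s \<in> space (\<Pi>\<^sub>M n\<in>UNIV. \<Theta>)"
  shows "prob_space (\<eta> (s n))" "sets (\<eta> (s n)) = sets rvec_space"
  using measurable_space[OF assms(1), of "s n"] assms(2)
  by (auto simp: space_prob_algebra space_PiM PiE_iff)

lemma sets_quenched:
  assumes "\<eta> \<in> \<Theta> \<rightarrow>\<^sub>M prob_algebra rvec_space" "s \<in> space (\<Pi>\<^sub>M n\<in>UNIV. \<Theta>)"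
  shows "sets (quenched \<eta> s) = sets config_space"
  unfolding quenched_def config_space_def
  by (intro sets_PiM_cong) (auto simp: prob_space_rvec_law[OF assms])

lemma prob_space_quenched:
  assumes "\<eta> \<in> \<Theta> \<rightarrow>\<^sub>M prob_algebra rvec_space" "s \<in> space (\<Pi>\<^sub>M n\<in>UNIV. \<Theta>)"
  shows "prob_space (quenched \<eta> s)"
  unfolding quenched_def by (intro prob_space_PiM prob_space_rvec_law[OF assms])

lemma measurable_quenched:
  assumes eta: "\<eta> \<in> \<Theta> \<rightarrow>\<^sub>M prob_algebra rvec_space"
  shows "quenched \<eta> \<in> (\<Pi>\<^sub>M n\<in>UNIV. \<Theta>) \<rightarrow>\<^sub>M prob_algebra config_space"
proof (rule measurable_prob_algebra_generated[where
      \<Omega> = "\<Pi>\<^sub>E u\<in>UNIV. space rvec_space" and G = "prod_algebra UNIV (\<lambda>_. rvec_space)"])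
  show "sets config_space = sigma_sets (\<Pi>\<^sub>E u\<in>UNIV. space rvec_space) (prod_algebra UNIV (\<lambda>_. rvec_space))"
    unfolding config_space_def by (rule sets_PiM)
  show "Int_stable (prod_algebra UNIV (\<lambda>_. rvec_space))" by (rule Int_stable_prod_algebra)
  show "prod_algebra UNIV (\<lambda>_. rvec_space) \<subseteq> Pow (\<Pi>\<^sub>E u\<in>UNIV. space rvec_space)"
    by (rule prod_algebra_sets_into_space)
  fix A :: "config set" assume "A \<in> prod_algebra UNIV (\<lambda>_. rvec_space)"
  then obtain J E where A: "A = prod_emb UNIV (\<lambda>_. rvec_space) J (\<Pi>\<^sub>E u\<in>J. E u)"
    and J: "finite J" and E: "\<And>u. u \<in> J \<Longrightarrow> E u \<in> sets rvec_space"
    by (rule prod_algebraE) auto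
  have eq: "emeasure (quenched \<eta> s) A = (\<Prod>u\<in>J. emeasure (\<eta> (s (length u))) (E u))"
    if s: "s \<in> space (\<Pi>\<^sub>M n\<in>UNIV. \<Theta>)" for s
  proof -
    have "A = prod_emb UNIV (\<lambda>u. \<eta> (s (length u))) J (\<Pi>\<^sub>E u\<in>J. E u)"
      unfolding A prod_emb_def
      by (simp add: sets_eq_imp_space_eq[OF prob_space_rvec_law(2)[OF eta s]])
    then show ?thesis
      unfolding quenched_def using J E prob_space_rvec_law[OF eta s]
      by (simp add: emeasure_PiM_emb)
  qed
  have "(\<lambda>s. \<Prod>u\<in>J. emeasure (\<eta> (s (length u))) (E u)) \<in> borel_measurable (\<Pi>\<^sub>M n\<in>UNIV. \<Theta>)"
  proof (rule borel_measurable_prod_ennreal)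
    fix u assume "u \<in> J"
    have "(\<lambda>s. \<eta> (s (length u))) \<in> (\<Pi>\<^sub>M n\<in>UNIV. \<Theta>) \<rightarrow>\<^sub>M subprob_algebra rvec_space"
      by (rule measurable_compose[OF _ measurable_prob_algebraD[OF eta]])
         (rule measurable_component_singleton, simp)
    then show "(\<lambda>s. emeasure (\<eta> (s (length u))) (E u)) \<in> borel_measurable (\<Pi>\<^sub>M n\<in>UNIV. \<Theta>)"
      by (rule measurable_compose[OF _ measurable_emeasure_subprob_algebra]) (rule E[OF \<open>u \<in> J\<close>])
  qed
  then show "(\<lambda>s. emeasure (quenched \<eta> s) A) \<in> borel_measurable (\<Pi>\<^sub>M n\<in>UNIV. \<Theta>)"
    by (subst measurable_cong[OF eq])
qed (use prob_space_quenched[OF eta] sets_quenched[OF eta] in auto)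

lemma measurable_quenched_pair:
  assumes eta: "\<eta> \<in> \<Theta> \<rightarrow>\<^sub>M prob_algebra rvec_space"
    and tau: "sets \<tau> = sets (\<Pi>\<^sub>M n\<in>UNIV. \<Theta>)"
  shows "(\<lambda>s. distr (quenched \<eta> s) (\<tau> \<Otimes>\<^sub>M config_space) (\<lambda>X. (s, X)))
           \<in> \<tau> \<rightarrow>\<^sub>M prob_algebra (\<tau> \<Otimes>\<^sub>M config_space)"
proof -
  have "quenched \<eta> \<in> \<tau> \<rightarrow>\<^sub>M prob_algebra config_space"
    using measurable_quenched[OF eta] by (simp cong: measurable_cong_sets add: tau)
  then show ?thesis
    by (intro measurable_distr_prob_space2[where M = config_space]) auto
qed

lemma prob_space_annealed:
  assumes "\<eta> \<in> \<Theta> \<rightarrow>\<^sub>M prob_algebra rvec_space"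
    and "prob_space \<tau>" "sets \<tau> = sets (\<Pi>\<^sub>M n\<in>UNIV. \<Theta>)"
  shows "prob_space (annealed \<eta> \<tau>)"
  unfolding annealed_def
  by (rule prob_space_bind'[OF _ measurable_quenched_pair[OF assms(1,3)]])
     (use assms(2) in \<open>simp add: space_prob_algebra\<close>)

section \<open>Quenched moments\<close>

text \<open>
  Quantities attached to \<open>|u| = n\<close> depend on \<open>u\<close> only through its length, since \<open>X(u)\<close> has
  quenched law \<open>\<eta> (\<xi> n)\<close>; they are evaluated at the sequence \<open>u\<close> consisting of \<open>n\<close> zeros.
\<close>

lemma distr_quenched_component:
  assumes "\<eta> \<in> \<Theta> \<rightarrow>\<^sub>M prob_algebra rvec_space" "s \<in> space (\<Pi>\<^sub>M n\<in>UNIV. \<Theta>)"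
  shows "distr (quenched \<eta> s) (\<eta> (s (length u))) (\<lambda>X. X u) = \<eta> (s (length u))"
  unfolding quenched_def
  by (rule distr_PiM_component[where M = "\<lambda>u. \<eta> (s (length u))"])
     (auto simp: prob_space_rvec_law[OF assms])

abbreviation rep :: "nat \<Rightarrow> nat list" where
  "rep n \<equiv> replicate n 0"

definition mean_offspring :: "('e \<Rightarrow> rvec measure) \<Rightarrow> (nat \<Rightarrow> 'e) \<Rightarrow> nat \<Rightarrow> ennreal" where
  "mean_offspring \<eta> s n = (\<integral>\<^sup>+ X. of_nat (offspring X (rep n)) \<partial>quenched \<eta> s)"

definition displacement_sum :: "nat \<Rightarrow> config \<Rightarrow> real" where
  "displacement_sum n X = (\<Sum>i<offspring X (rep n). displacement X (rep n) i)"

text \<open>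
  The Bochner integral is 0 for a non-integrable function, so this is \<open>\<mu>\<^sub>n\<close> only where
  \<open>displacement_sum n\<close> is integrable and the mean offspring is positive and finite.
\<close>

definition mean_displacement :: "('e \<Rightarrow> rvec measure) \<Rightarrow> (nat \<Rightarrow> 'e) \<Rightarrow> nat \<Rightarrow> real" where
  "mean_displacement \<eta> s n =
     (\<integral> X. displacement_sum n X \<partial>quenched \<eta> s) / enn2real (mean_offspring \<eta> s n)"

definition var_displacement :: "('e \<Rightarrow> rvec measure) \<Rightarrow> (nat \<Rightarrow> 'e) \<Rightarrow> nat \<Rightarrow> ennreal" where
  "var_displacement \<eta> s n =
     (\<integral>\<^sup>+ X. ennreal (\<Sum>i<offspring X (rep n).
        (displacement X (rep n) i - mean_displacement \<eta> s n)\<^sup>2) \<partial>quenched \<eta> s)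
     / mean_offspring \<eta> s n"

definition centering :: "('e \<Rightarrow> rvec measure) \<Rightarrow> (nat \<Rightarrow> 'e) \<Rightarrow> nat \<Rightarrow> real" where
  "centering \<eta> s n = (\<Sum>i<n. mean_displacement \<eta> s i)"

definition scaling :: "('e \<Rightarrow> rvec measure) \<Rightarrow> (nat \<Rightarrow> 'e) \<Rightarrow> nat \<Rightarrow> real" where
  "scaling \<eta> s n = sqrt (enn2real (\<Sum>i<n. var_displacement \<eta> s i))"

definition quenched_intensity :: "('e \<Rightarrow> rvec measure) \<Rightarrow> (nat \<Rightarrow> 'e) \<Rightarrow> nat \<Rightarrow> real set \<Rightarrow> ennreal" where
  "quenched_intensity \<eta> s n A = (\<integral>\<^sup>+ X. emeasure (counting_measure X n) A \<partial>quenched \<eta> s)"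

definition log_plus :: "real \<Rightarrow> real" where
  "log_plus x = max 0 (ln x)"

end

theory Submission
  imports Defs "HOL-Real_Asymp.Real_Asymp"
begin

text \<open>
  By the many-to-one formula the normalized quenched intensity of generation \<open>n\<close> is the law of a sum
  of \<open>n\<close> independent variables, the \<open>k\<close>-th having as law the normalized intensity of the displacements
  in generation \<open>k\<close>, with mean \<open>\<mu>\<^sub>k\<close> and variance \<open>\<sigma>\<^sub>k\<^sup>2\<close>. For almost every environment these variables satisfy
  Lindeberg's condition: the ergodic theorem makes \<open>b\<^sub>n\<^sup>2\<close> grow at least linearly, while the truncated
  second moments at a fixed level \<open>K\<close> have averages bounded by a quantity that vanishes as \<open>K \<rightarrow> \<infinity>\<close>. Of
  the ergodic theorem one only needs that the Birkhoff sums of a function with negative mean are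
  bounded above almost surely.
\<close>

section \<open>Birkhoff sums of a function with negative mean\<close>

text \<open>Given the environment, the summands are independent but not identically distributed, and
  the Lindeberg level \<open>\<epsilon> * b n\<close> moves with n and with the environment, so the
  truncated second moments are not the values of one function along the orbit of the shift. A fixed
  level K removes this obstacle: truncated moments decrease in the level, and the moving level
  eventually passes K. What remains is one-sided, a lower bound for sums of variances and an upper
  bound for sums of truncated variances. Each says that Birkhoff sums of a function with negative
  mean stay below a constant: half the mean variance minus the variance in one case, the truncated
  variance minus 1/(j+1) in the other. The constant depends on the environment, but an additive
  constant disappears after division by n.\<close>

primrec birkhoff_max :: "('a \<Rightarrow> 'a) \<Rightarrow> ('a \<Rightarrow> real) \<Rightarrow> nat \<Rightarrow> 'a \<Rightarrow> real" where
  "birkhoff_max T g 0 x = 0"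
| "birkhoff_max T g (Suc n) x = max 0 (g x + birkhoff_max T g n (T x))"

lemma birkhoff_max_nonneg: "0 \<le> birkhoff_max T g n x"
  by (cases n) auto

lemma birkhoff_max_mono_Suc: "birkhoff_max T g n x \<le> birkhoff_max T g (Suc n) x"
proof (induction n arbitrary: x)
  case (Suc n)
  show ?case using Suc[of "T x"] by simp
qed simp

text \<open>\<open>birkhoff_max T g n x\<close> is the maximum of the Birkhoff sums of lengths 0 to
  n. Its recursion peels off the first point of the orbit, so that comparing it with a value at
  \<open>T x\<close> takes a single unfolding.\<close>

lemma birkhoff_sum_le_max: "(\<Sum>k<n. g ((T ^^ k) x)) \<le> birkhoff_max T g n x"
proof (induction n arbitrary: x)
  case (Suc n)
  have "(\<Sum>k<Suc n. g ((T ^^ k) x)) = g x + (\<Sum>k<n. g ((T ^^ k) (T x)))"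
    by (subst sum.lessThan_Suc_shift) (simp add: funpow_swap1)
  then show ?case using Suc[of "T x"] by simp
qed simp

text \<open>
  On the invariant set \<open>A\<close> where the maxima \<open>m\<^sub>n\<close> of the Birkhoff sums are unbounded,
  \<open>m\<^bsub>n+1\<^esub> - m\<^sub>n \<circ> T\<close> is eventually equal to \<open>g\<close>, although its integral is nonnegative for every \<open>n\<close>.
\<close>

lemma (in prob_space) birkhoff_sums_bounded_above:
  fixes g :: "'a \<Rightarrow> real"
  assumes T: "T \<in> M \<rightarrow>\<^sub>M M" and invariant: "distr M M T = M"
    and ergodic: "\<And>A. A \<in> sets M \<Longrightarrow> {x \<in> space M. T x \<in> A} = A \<Longrightarrow> prob A = 0 \<or> prob A = 1"
    and g: "integrable M g" and neg: "expectation g < 0"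
  shows "AE x in M. \<exists>C. \<forall>n. (\<Sum>k<n. g ((T ^^ k) x)) \<le> C"
proof -
  let ?m = "birkhoff_max T g"
  note [measurable] = T
  have [measurable]: "g \<in> borel_measurable M" using g by auto
  have int_T: "integrable M (\<lambda>x. f (T x)) \<and> (\<integral>x. f (T x) \<partial>M) = (\<integral>x. f x \<partial>M)"
    if "integrable M f" for f :: "'a \<Rightarrow> real"
    using that T integrable_distr_eq[OF T, of f] integral_distr[OF T, of f] invariant by auto
  have int_m: "integrable M (?m n)" for n
  proof (induction n)
    case (Suc n)
    have "integrable M (\<lambda>x. max 0 (g x + ?m n (T x)))"
      using int_T[OF Suc] g by (intro integrable_max) auto
    then show ?case by (simp cong: integrable_cong)
  qed simp
  have [measurable]: "?m n \<in> borel_measurable M" for n using int_m by auto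
  define A where "A = {x \<in> space M. \<forall>c::nat. \<exists>n. c < ?m n x}"
  have A[measurable]: "A \<in> sets M" unfolding A_def by measurable
  \<comment> \<open>\<open>ergodic\<close> asks for an exactly invariant set. \<open>A\<close> is
    one because \<open>?m (Suc n) x\<close> and \<open>?m n (T x)\<close> differ by at most
    \<open>\<bar>g x\<bar>\<close> for every n, so they are unbounded together.\<close>
  have unbounded_T: "(\<forall>c::nat. \<exists>n. c < ?m n (T x)) \<longleftrightarrow> (\<forall>c::nat. \<exists>n. c < ?m n x)" for x
  proof
    assume *: "\<forall>c::nat. \<exists>n. c < ?m n (T x)"
    show "\<forall>c::nat. \<exists>n. c < ?m n x"
    proof
      fix c :: nat
      obtain d :: nat where d: "c - g x \<le> d" using real_arch_simple by blast
      obtain n where "d < ?m n (T x)" using * by blast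
      with d have "c < ?m (Suc n) x" by simp
      then show "\<exists>n. c < ?m n x" by blast
    qed
  next
    assume *: "\<forall>c::nat. \<exists>n. c < ?m n x"
    show "\<forall>c::nat. \<exists>n. c < ?m n (T x)"
    proof
      fix c :: nat
      obtain d :: nat where d: "c + \<bar>g x\<bar> \<le> d" using real_arch_simple by blast
      obtain n where n: "d < ?m n x" using * by blast
      with d obtain k where k: "n = Suc k" by (cases n) auto
      show "\<exists>n. c < ?m n (T x)"
        using n d unfolding k by (intro exI[of _ k]) (auto split: if_splits simp: max_def)
    qed
  qed
  have "{x \<in> space M. T x \<in> A} = A"
    unfolding A_def using unbounded_T measurable_space[OF T] by auto
  moreover have "prob A \<noteq> 1"
  proof
    assume "prob A = 1"
    then have ae: "AE x in M. x \<in> A" using prob_eq_1 A by blast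
    let ?h = "\<lambda>n x. ?m (Suc n) x - ?m n (T x)"
    have h: "\<bar>?h n x\<bar> \<le> \<bar>g x\<bar>" for n x
      using birkhoff_max_nonneg[of T g n "T x"] by (auto simp: max_def)
    \<comment> \<open>\<open>?h n x\<close> is the maximum of \<open>g x\<close> and
      \<open>- ?m n (T x)\<close>. On \<open>A\<close> the second term eventually drops below the
      first, since the maxima at \<open>T x\<close> increase without bound.\<close>
    have lim: "(\<lambda>n. ?h n x) \<longlonglongrightarrow> g x" if x: "x \<in> A" for x
    proof (rule tendsto_eventually)
      obtain d :: nat where d: "\<bar>g x\<bar> \<le> d" using real_arch_simple by blast
      have "\<forall>c::nat. \<exists>n. c < ?m n (T x)" using x unfolding A_def unbounded_T by simp
      then obtain k where k: "d < ?m k (T x)" by blast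
      show "\<forall>\<^sub>F n in sequentially. ?h n x = g x"
      proof (rule eventually_sequentiallyI[of k])
        fix n assume "k \<le> n"
        then have "?m k (T x) \<le> ?m n (T x)"
          by (rule lift_Suc_mono_le[of "\<lambda>n. ?m n (T x)", OF birkhoff_max_mono_Suc])
        then show "?h n x = g x" using k d by (auto simp: max_def)
      qed
    qed
    have "(\<lambda>n. \<integral>x. ?h n x \<partial>M) \<longlonglongrightarrow> (\<integral>x. g x \<partial>M)"
      using ae lim h g by (intro integral_dominated_convergence[where w="\<lambda>x. \<bar>g x\<bar>"]) auto
    \<comment> \<open>Invariance replaces the integral of \<open>?m n (T x)\<close> by that of
      \<open>?m n x\<close>, and the maxima increase with n.\<close>
    moreover have "0 \<le> (\<integral>x. ?h n x \<partial>M)" for n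
    proof -
      have "(\<integral>x. ?h n x \<partial>M) = (\<integral>x. ?m (Suc n) x \<partial>M) - (\<integral>x. ?m n x \<partial>M)"
        using int_T[OF int_m[of n]] int_m[of "Suc n"] by (subst Bochner_Integration.integral_diff) auto
      also have "\<dots> \<ge> 0" using integral_mono[OF int_m[of n] int_m[of "Suc n"] birkhoff_max_mono_Suc] by simp
      finally show ?thesis .
    qed
    ultimately have "0 \<le> (\<integral>x. g x \<partial>M)" by (intro LIMSEQ_le_const) auto
    with neg show False by simp
  qed
  ultimately have "prob A = 0" using ergodic[OF A] by blast
  then have "AE x in M. x \<notin> A" using A by (simp add: prob_eq_0)
  with AE_space show ?thesis
  proof eventually_elim
    case (elim x)
    then obtain c :: nat where "\<And>n. ?m n x \<le> c" unfolding A_def by (auto simp: not_less)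
    then show ?case by (intro exI[of _ "real c"] allI order_trans[OF birkhoff_sum_le_max])
  qed
qed

section \<open>Lindeberg's central limit theorem\<close>

text \<open>Serves to replace the factor 1 - a in the expansion of a characteristic function by exp
  (- a), so that the product over the summands is exactly the normal characteristic function. The
  auxiliary \<open>f\<close> vanishes at 0 and has nonnegative derivative.\<close>

lemma exp_minus_approx:
  fixes a :: real assumes "0 \<le> a" shows "\<bar>exp (- a) - (1 - a)\<bar> \<le> a\<^sup>2 / 2"
proof -
  define f where "f x = 1 - x + x\<^sup>2 / 2 - exp (- x)" for x :: real
  have "f 0 \<le> f a"
  proof (rule DERIV_nonneg_imp_nondecreasing[OF assms])
    fix x :: real assume "0 \<le> x"
    have "(f has_real_derivative (x - 1 + exp (- x))) (at x)"
      unfolding f_def by (auto intro!: derivative_eq_intros)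
    moreover have "0 \<le> x - 1 + exp (- x)" using exp_ge_add_one_self[of "- x"] by simp
    ultimately show "\<exists>y. (f has_real_derivative y) (at x) \<and> 0 \<le> y" by blast
  qed
  moreover have "1 - a \<le> exp (- a)" using exp_ge_add_one_self[of "- a"] by simp
  ultimately show ?thesis by (simp add: f_def)
qed

text \<open>The characteristic function of the normalized sum and the normal one are both products
  of n factors of modulus at most 1, the latter with exponents that share t^2/2 in proportion to the
  variances. The difference of such products is at most the sum of the differences of their
  factors.\<close>

theorem (in prob_space) lindeberg_central_limit_theorem:
  fixes X :: "nat \<Rightarrow> 'a \<Rightarrow> real"
  assumes indep: "indep_vars (\<lambda>_. borel) X UNIV"
    and sq_int: "\<And>k. integrable M (\<lambda>x. (X k x)\<^sup>2)"
    and mean: "\<And>k. expectation (X k) = 0"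
  defines "b n \<equiv> sqrt (\<Sum>k<n. expectation (\<lambda>x. (X k x)\<^sup>2))"
  assumes b_pos: "\<forall>\<^sub>F n in sequentially. 0 < b n"
    and lindeberg: "\<And>\<epsilon>. 0 < \<epsilon> \<Longrightarrow>
      (\<lambda>n. (\<Sum>k<n. expectation (\<lambda>x. (X k x)\<^sup>2 * of_bool (\<epsilon> * b n < \<bar>X k x\<bar>))) / (b n)\<^sup>2) \<longlonglongrightarrow> 0"
  shows "weak_conv_m (\<lambda>n. distr M borel (\<lambda>x. (\<Sum>k<n. X k x) / b n)) std_normal_distribution"
proof (rule levy_continuity)
  have rv[measurable]: "random_variable borel (X k)" for k
    using indep unfolding indep_vars_def2 by simp
  have int[simp]: "integrable M (X k)" for k
    by (rule square_integrable_imp_integrable[OF rv sq_int])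
  note sq_int[simp]
  have "(\<lambda>x. (\<Sum>k<n. X k x) / b n) \<in> borel_measurable M" for n by measurable
  then show "real_distribution (distr M borel (\<lambda>x. (\<Sum>k<n. X k x) / b n))" for n
    by (rule real_distribution_distr)
  show "real_distribution std_normal_distribution"
    by (rule real_dist_normal_dist)
  define \<sigma>2 where "\<sigma>2 k = expectation (\<lambda>x. (X k x)\<^sup>2)" for k
  define L where "L \<epsilon> n = (\<Sum>k<n. expectation (\<lambda>x. (X k x)\<^sup>2 * of_bool (\<epsilon> * b n < \<bar>X k x\<bar>))) / (b n)\<^sup>2" for \<epsilon> n
  have \<sigma>2_nonneg: "0 \<le> \<sigma>2 k" for k by (simp add: \<sigma>2_def)
  have b2: "(b n)\<^sup>2 = (\<Sum>k<n. \<sigma>2 k)" for n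
    unfolding b_def using \<sigma>2_nonneg by (subst real_sqrt_pow2) (auto intro: sum_nonneg simp: \<sigma>2_def)
  have int_tail: "integrable M (\<lambda>x. (X k x)\<^sup>2 * of_bool (c < \<bar>X k x\<bar>))" for k c
    by (rule Bochner_Integration.integrable_bound[OF sq_int[of k]]) auto
  fix t :: real
  let ?c = "\<lambda>n. char (distr M borel (\<lambda>x. (\<Sum>k<n. X k x) / b n)) t"
  \<comment> \<open>The errors come from the summands beyond \<open>\<epsilon> * b n\<close>, from
    the third-order Taylor remainder below that level, and from replacing \<open>1 - a k\<close> by
    \<open>exp (- a k)\<close>. As \<open>L \<epsilon> n\<close> is the Lindeberg ratio, only the
    terms in \<open>\<epsilon>\<close> alone survive as n grows, and \<open>\<epsilon>\<close> is
    chosen first to make them small.\<close>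
  have bound: "cmod (?c n - exp (- (t\<^sup>2) / 2)) \<le>
      t\<^sup>2 * L \<epsilon> n + \<bar>t\<bar> ^ 3 * \<epsilon> / 6 + t ^ 4 / 8 * (\<epsilon>\<^sup>2 + L \<epsilon> n)"
    if \<epsilon>: "0 < \<epsilon>" and bn: "0 < b n" for \<epsilon> n
  proof -
    define \<phi> where "\<phi> k = char (distr M borel (X k)) (t / b n)" for k
    define a where "a k = t\<^sup>2 * \<sigma>2 k / (2 * (b n)\<^sup>2)" for k
    define T where "T k = expectation (\<lambda>x. (X k x)\<^sup>2 * of_bool (\<epsilon> * b n < \<bar>X k x\<bar>))" for k
    have T_nonneg: "0 \<le> T k" for k unfolding T_def by simp
    have LT: "L \<epsilon> n = (\<Sum>k<n. T k) / (b n)\<^sup>2" by (simp add: L_def T_def)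
    have a_nonneg: "0 \<le> a k" for k by (simp add: a_def \<sigma>2_nonneg)
    have sum_a: "(\<Sum>k<n. a k) = t\<^sup>2 / 2"
      using bn unfolding a_def by (simp add: sum_divide_distrib[symmetric] sum_distrib_left[symmetric] b2[symmetric])
    have char_scale: "char (distr M borel (\<lambda>x. X k x / b n)) t = \<phi> k" for k
      unfolding \<phi>_def char_def by (simp add: integral_distr)
    have "?c n = (\<Prod>k<n. char (distr M borel (\<lambda>x. X k x / b n)) t)"
      unfolding sum_divide_distrib
      by (rule char_distr_sum, rule indep_vars_compose2[where X=X], rule indep_vars_subset[OF indep]) auto
    then have c: "?c n = (\<Prod>k<n. \<phi> k)" by (simp add: char_scale)
    have e: "(exp (- (t\<^sup>2) / 2) :: complex) = (\<Prod>k<n. of_real (exp (- a k)))"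
    proof -
      have "exp (- (t\<^sup>2) / 2) = (\<Prod>k<n. exp (- a k))"
        using sum_a by (simp add: exp_sum[symmetric] sum_negf)
      from this[THEN arg_cong[where f=complex_of_real]] show ?thesis
        by (simp add: exp_of_real flip: exp_of_real)
    qed
    have \<phi>_le: "cmod (\<phi> k) \<le> 1" for k
      unfolding \<phi>_def using real_distribution.cmod_char_le_1[OF real_distribution_distr[OF rv]] .
    have step: "cmod (\<phi> k - of_real (exp (- a k))) \<le>
        t\<^sup>2 * T k / (b n)\<^sup>2 + \<bar>t\<bar> ^ 3 * \<epsilon> / 6 * (\<sigma>2 k / (b n)\<^sup>2) + (a k)\<^sup>2 / 2" for k
    proof -
      let ?u = "t / b n"
      have "cmod (\<phi> k - (1 - ?u\<^sup>2 * \<sigma>2 k / 2)) \<le>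
          ?u\<^sup>2 / 6 * expectation (\<lambda>x. min (6 * (X k x)\<^sup>2) (\<bar>?u\<bar> * \<bar>X k x\<bar> ^ 3))"
        unfolding \<phi>_def by (rule char_approx3') (auto simp: mean \<sigma>2_def)
      \<comment> \<open>Beyond the level the quadratic entry of the minimum is used; below it, the
        factor \<open>\<bar>X k x\<bar> / b n\<close> of the cubic entry is at most
        \<open>\<epsilon>\<close>.\<close>
      also have "expectation (\<lambda>x. min (6 * (X k x)\<^sup>2) (\<bar>?u\<bar> * \<bar>X k x\<bar> ^ 3))
          \<le> expectation (\<lambda>x. 6 * ((X k x)\<^sup>2 * of_bool (\<epsilon> * b n < \<bar>X k x\<bar>)) + \<bar>t\<bar> * \<epsilon> * (X k x)\<^sup>2)"
      proof (rule integral_mono)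
        show "integrable M (\<lambda>x. min (6 * (X k x)\<^sup>2) (\<bar>?u\<bar> * \<bar>X k x\<bar> ^ 3))"
          by (rule Bochner_Integration.integrable_bound[where f="\<lambda>x. 6 * (X k x)\<^sup>2"]) auto
        show "integrable M (\<lambda>x. 6 * ((X k x)\<^sup>2 * of_bool (\<epsilon> * b n < \<bar>X k x\<bar>)) + \<bar>t\<bar> * \<epsilon> * (X k x)\<^sup>2)"
          using int_tail by simp
        fix x
        show "min (6 * (X k x)\<^sup>2) (\<bar>?u\<bar> * \<bar>X k x\<bar> ^ 3)
            \<le> 6 * ((X k x)\<^sup>2 * of_bool (\<epsilon> * b n < \<bar>X k x\<bar>)) + \<bar>t\<bar> * \<epsilon> * (X k x)\<^sup>2"
        proof (cases "\<epsilon> * b n < \<bar>X k x\<bar>")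
          case True
          then show ?thesis using \<epsilon> by (simp add: min_le_iff_disj)
        next
          case False
          then have "\<bar>X k x\<bar> / b n \<le> \<epsilon>" using bn by (simp add: divide_le_eq)
          then have "\<bar>t\<bar> * (X k x)\<^sup>2 * (\<bar>X k x\<bar> / b n) \<le> \<bar>t\<bar> * (X k x)\<^sup>2 * \<epsilon>"
            by (rule mult_left_mono) simp
          then have "\<bar>?u\<bar> * \<bar>X k x\<bar> ^ 3 \<le> \<bar>t\<bar> * \<epsilon> * (X k x)\<^sup>2"
            using bn by (simp add: power3_eq_cube power2_eq_square mult_ac)
          with False show ?thesis by (simp add: min_le_iff_disj)
        qed
      qed
      also have "\<dots> = 6 * T k + \<bar>t\<bar> * \<epsilon> * \<sigma>2 k"
        using int_tail by (simp add: T_def \<sigma>2_def)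
      finally have "cmod (\<phi> k - (1 - ?u\<^sup>2 * \<sigma>2 k / 2)) \<le> ?u\<^sup>2 / 6 * (6 * T k + \<bar>t\<bar> * \<epsilon> * \<sigma>2 k)"
        by (simp add: mult_left_mono)
      also have "\<dots> = t\<^sup>2 * T k / (b n)\<^sup>2 + \<bar>t\<bar> ^ 3 * \<epsilon> / 6 * (\<sigma>2 k / (b n)\<^sup>2)"
        using bn by (simp add: field_simps power2_eq_square power3_eq_cube)
      finally have 1: "cmod (\<phi> k - of_real (1 - a k)) \<le> \<dots>"
        using bn by (simp add: a_def power_divide mult.commute[of 2])
      have "cmod (of_real (1 - a k) - of_real (exp (- a k))) = \<bar>exp (- a k) - (1 - a k)\<bar>"
        by (simp only: of_real_diff[symmetric] norm_of_real abs_minus_commute)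
      also have "\<dots> \<le> (a k)\<^sup>2 / 2" by (rule exp_minus_approx[OF a_nonneg])
      finally show ?thesis using 1 norm_triangle_sub norm_diff_triangle_le by fastforce
    qed
    \<comment> \<open>No single variance dominates: below the level the second moment is at most
      \<open>(\<epsilon> * b n)\<^sup>2\<close>, and the rest is a Lindeberg tail. The squares of
      the \<open>a k\<close> then sum to at most this uniform bound times t^2/2, and halving gives
      the constant t^4/8.\<close>
    have a_le: "a k \<le> t\<^sup>2 / 2 * (\<epsilon>\<^sup>2 + L \<epsilon> n)" if "k < n" for k
    proof -
      have "\<sigma>2 k \<le> expectation (\<lambda>x. \<epsilon>\<^sup>2 * (b n)\<^sup>2 + (X k x)\<^sup>2 * of_bool (\<epsilon> * b n < \<bar>X k x\<bar>))"
        unfolding \<sigma>2_def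
      proof (rule integral_mono)
        fix x
        show "(X k x)\<^sup>2 \<le> \<epsilon>\<^sup>2 * (b n)\<^sup>2 + (X k x)\<^sup>2 * of_bool (\<epsilon> * b n < \<bar>X k x\<bar>)"
        proof (cases "\<epsilon> * b n < \<bar>X k x\<bar>")
          case False
          then have "\<bar>X k x\<bar>\<^sup>2 \<le> (\<epsilon> * b n)\<^sup>2" by (intro power_mono) auto
          with False show ?thesis by (simp add: power_mult_distrib)
        qed simp
      qed (use int_tail in auto)
      also have "\<dots> = \<epsilon>\<^sup>2 * (b n)\<^sup>2 + T k" using int_tail by (simp add: T_def prob_space)
      also have "T k \<le> (\<Sum>k<n. T k)" using that T_nonneg by (intro member_le_sum) auto
      finally have "\<sigma>2 k / (b n)\<^sup>2 \<le> (\<epsilon>\<^sup>2 * (b n)\<^sup>2 + (\<Sum>k<n. T k)) / (b n)\<^sup>2"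
        by (simp add: divide_right_mono)
      also have "\<dots> = \<epsilon>\<^sup>2 + L \<epsilon> n" using bn by (simp add: LT add_divide_distrib)
      finally have "t\<^sup>2 / 2 * (\<sigma>2 k / (b n)\<^sup>2) \<le> t\<^sup>2 / 2 * (\<epsilon>\<^sup>2 + L \<epsilon> n)"
        by (rule mult_left_mono) simp
      then show ?thesis by (simp add: a_def)
    qed
    have "(\<Sum>k<n. (a k)\<^sup>2 / 2) \<le> (\<Sum>k<n. t\<^sup>2 / 2 * (\<epsilon>\<^sup>2 + L \<epsilon> n) * a k / 2)"
    proof (intro sum_mono divide_right_mono)
      fix k assume "k \<in> {..<n}"
      then show "(a k)\<^sup>2 \<le> t\<^sup>2 / 2 * (\<epsilon>\<^sup>2 + L \<epsilon> n) * a k"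
        using mult_right_mono[OF a_le a_nonneg] by (simp add: power2_eq_square[of "a k"])
    qed simp
    also have "\<dots> = t\<^sup>2 / 2 * (\<epsilon>\<^sup>2 + L \<epsilon> n) * (\<Sum>k<n. a k) / 2"
      by (simp add: sum_distrib_left sum_divide_distrib)
    also have "\<dots> = t ^ 4 / 8 * (\<epsilon>\<^sup>2 + L \<epsilon> n)" unfolding sum_a by (simp add: power4_eq_xxxx power2_eq_square[of t])
    finally have 3: "(\<Sum>k<n. (a k)\<^sup>2 / 2) \<le> \<dots>" .
    have "cmod (?c n - exp (- (t\<^sup>2) / 2)) \<le> (\<Sum>k<n. cmod (\<phi> k - of_real (exp (- a k))))"
      unfolding c e using \<phi>_le a_nonneg by (intro norm_prod_diff) auto
    also have "\<dots> \<le> (\<Sum>k<n. t\<^sup>2 * T k / (b n)\<^sup>2 + \<bar>t\<bar> ^ 3 * \<epsilon> / 6 * (\<sigma>2 k / (b n)\<^sup>2) + (a k)\<^sup>2 / 2)"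
      by (intro sum_mono step)
    also have "\<dots> = t\<^sup>2 * L \<epsilon> n + \<bar>t\<bar> ^ 3 * \<epsilon> / 6 * ((\<Sum>k<n. \<sigma>2 k) / (b n)\<^sup>2) + (\<Sum>k<n. (a k)\<^sup>2 / 2)"
      by (simp add: sum.distrib LT sum_distrib_left sum_divide_distrib)
    also have "(\<Sum>k<n. \<sigma>2 k) / (b n)\<^sup>2 = 1" using bn by (simp flip: b2)
    finally show ?thesis using 3 by simp
  qed
  have "?c \<longlonglongrightarrow> exp (- (t\<^sup>2) / 2)"
  proof (rule tendstoI)
    fix e :: real assume e: "0 < e"
    have "((\<lambda>\<epsilon>. \<bar>t\<bar> ^ 3 * \<epsilon> / 6 + t ^ 4 / 8 * \<epsilon>\<^sup>2) \<longlongrightarrow> \<bar>t\<bar> ^ 3 * 0 / 6 + t ^ 4 / 8 * 0\<^sup>2) (at_right 0)"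
      by (intro tendsto_intros) auto
    then have "\<forall>\<^sub>F \<epsilon> in at_right 0. \<bar>t\<bar> ^ 3 * \<epsilon> / 6 + t ^ 4 / 8 * \<epsilon>\<^sup>2 < e"
      using e by (intro order_tendstoD(2)) auto
    then have "\<exists>\<epsilon>>0. \<bar>t\<bar> ^ 3 * \<epsilon> / 6 + t ^ 4 / 8 * \<epsilon>\<^sup>2 < e"
      unfolding eventually_at_right_field by (metis dense)
    then obtain \<epsilon> where \<epsilon>: "0 < \<epsilon>" "\<bar>t\<bar> ^ 3 * \<epsilon> / 6 + t ^ 4 / 8 * \<epsilon>\<^sup>2 < e" by blast
    have "L \<epsilon> \<longlonglongrightarrow> 0" using lindeberg[OF \<epsilon>(1)] by (simp add: L_def[abs_def])
    then have "(\<lambda>n. t\<^sup>2 * L \<epsilon> n + \<bar>t\<bar> ^ 3 * \<epsilon> / 6 + t ^ 4 / 8 * (\<epsilon>\<^sup>2 + L \<epsilon> n))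
        \<longlonglongrightarrow> t\<^sup>2 * 0 + \<bar>t\<bar> ^ 3 * \<epsilon> / 6 + t ^ 4 / 8 * (\<epsilon>\<^sup>2 + 0)"
      by (intro tendsto_intros)
    then have "\<forall>\<^sub>F n in sequentially. t\<^sup>2 * L \<epsilon> n + \<bar>t\<bar> ^ 3 * \<epsilon> / 6 + t ^ 4 / 8 * (\<epsilon>\<^sup>2 + L \<epsilon> n) < e"
      using \<epsilon>(2) by (intro order_tendstoD(2)) auto
    with b_pos show "\<forall>\<^sub>F n in sequentially. dist (?c n) (exp (- (t\<^sup>2) / 2)) < e"
    proof eventually_elim
      case (elim n)
      then show ?case using bound[OF \<epsilon>(1) elim(1)] by (simp add: dist_norm)
    qed
  qed
  then show "?c \<longlonglongrightarrow> char std_normal_distribution t"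
    by (simp add: char_std_normal_distribution flip: exp_of_real)
qed

text \<open>In the application \<open>r n\<close> is a sum of second moments truncated at
  \<open>\<epsilon> * sqrt (B n)\<close>. Linear growth of \<open>B\<close> pushes this level beyond
  any fixed \<open>K\<close>, after which \<open>tails\<close> controls \<open>r n\<close>.\<close>

lemma lindeberg_ratio_tendsto_0:
  fixes B :: "nat \<Rightarrow> real" and r :: "nat \<Rightarrow> real" and \<epsilon> c C :: real
  assumes "0 < \<epsilon>" and c: "0 < c" and growth: "\<And>n. c * n - C \<le> B n"
    and nonneg: "\<And>n. 0 \<le> r n"
    and tails: "\<And>\<delta>. 0 < \<delta> \<Longrightarrow> \<exists>K D. \<forall>n. K \<le> \<epsilon> * sqrt (B n) \<longrightarrow> r n \<le> \<delta> * n + D"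
  shows "(\<lambda>n. r n / B n) \<longlonglongrightarrow> 0"
proof (rule tendstoI)
  fix e :: real assume e: "0 < e"
  \<comment> \<open>A slope \<delta> in \<open>tails\<close> bounds \<open>r n / B n\<close>
    asymptotically by \<open>\<delta> / c\<close>. The choice made here gives e/4, which leaves room
    for the constants \<open>C\<close> and \<open>D\<close>.\<close>
  obtain K D where KD: "\<And>n. K \<le> \<epsilon> * sqrt (B n) \<Longrightarrow> r n \<le> e * c / 4 * n + D"
    using tails[of "e * c / 4"] e c by auto
  have "filterlim (\<lambda>n. c * real n - C) at_top sequentially"
    using c by real_asymp
  then have B: "filterlim B at_top sequentially"
    by (rule filterlim_at_top_mono) (simp add: growth)
  have "filterlim (\<lambda>n. \<epsilon> * sqrt (B n)) at_top sequentially"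
    by (rule filterlim_tendsto_pos_mult_at_top[OF tendsto_const \<open>0 < \<epsilon>\<close>])
       (rule filterlim_compose[OF sqrt_at_top B])
  then have 1: "\<forall>\<^sub>F n in sequentially. K \<le> \<epsilon> * sqrt (B n)"
    by (simp add: filterlim_at_top)
  have 2: "\<forall>\<^sub>F n in sequentially. e * c / 4 * n + D < e * (c * n - C)"
    using c e by real_asymp
  from 1 2 B[unfolded filterlim_at_top_dense, rule_format, of 0]
  show "\<forall>\<^sub>F n in sequentially. dist (r n / B n) 0 < e"
  proof eventually_elim
    case (elim n)
    have "r n < e * (c * n - C)" using KD[OF elim(1)] elim(2) by simp
    also have "\<dots> \<le> e * B n" using e growth by simp
    finally show ?case using nonneg[of n] elim(3) by (simp add: divide_less_eq)
  qed
qed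

section \<open>Sums of the coordinates of a product measure\<close>

lemma measure_std_normal_singleton: "measure std_normal_distribution {x} = 0"
proof -
  have "emeasure std_normal_distribution {x} = (\<integral>\<^sup>+ y. ennreal (std_normal_density y) * indicator {x} y \<partial>lborel)"
    by (subst emeasure_density) auto
  also have "\<dots> = 0"
  proof (subst nn_integral_0_iff_AE)
    show "AE y in lborel. ennreal (std_normal_density y) * indicator {x} y = 0"
      using AE_lborel_singleton[of x] by eventually_elim simp
  qed simp
  finally show ?thesis by (simp add: measure_def)
qed

lemma indep_vars_PiM_components:
  assumes "\<And>i. prob_space (\<nu> i)"
  shows "prob_space.indep_vars (Pi\<^sub>M UNIV \<nu>) \<nu> (\<lambda>i y. y i) UNIV"
proof -
  interpret P: prob_space "Pi\<^sub>M UNIV \<nu>" by (intro prob_space_PiM assms)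
  have "distr (Pi\<^sub>M UNIV \<nu>) (Pi\<^sub>M UNIV \<nu>) (\<lambda>y. restrict y UNIV) = distr (Pi\<^sub>M UNIV \<nu>) (Pi\<^sub>M UNIV \<nu>) (\<lambda>y. y)"
    by (simp add: restrict_UNIV)
  moreover have "distr (Pi\<^sub>M UNIV \<nu>) (\<nu> i) (\<lambda>y. y i) = \<nu> i" for i
    by (rule distr_PiM_component) (auto simp: assms)
  ultimately show ?thesis
    by (subst P.indep_vars_iff_distr_eq_PiM') (auto simp: distr_id restrict_UNIV)
qed

text \<open>The additive constants in \<open>growth\<close> and \<open>tails\<close> are what
  bounded Birkhoff sums provide, and the level \<open>K\<close> is chosen before n. The conclusion
  speaks of the unnormalized sum because this is the law that the many-to-one formula
  delivers.\<close>

lemma product_central_limit_theorem: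
  fixes \<nu> :: "nat \<Rightarrow> real measure" and \<mu> :: "nat \<Rightarrow> real" and c C :: real
  assumes prob: "\<And>k. prob_space (\<nu> k)" and sets[measurable_cong]: "\<And>k. sets (\<nu> k) = sets borel"
    and sq_int: "\<And>k. integrable (\<nu> k) (\<lambda>y. (y - \<mu> k)\<^sup>2)"
    and mean: "\<And>k. (\<integral>y. y - \<mu> k \<partial>\<nu> k) = 0"
  defines "B n \<equiv> \<Sum>k<n. \<integral>y. (y - \<mu> k)\<^sup>2 \<partial>\<nu> k"
  assumes c: "0 < c" and growth: "\<And>n. c * n - C \<le> B n"
    and tails: "\<And>\<delta>. 0 < \<delta> \<Longrightarrow> \<exists>K D. \<forall>n.
      (\<Sum>k<n. \<integral>y. (y - \<mu> k)\<^sup>2 * of_bool (K < \<bar>y - \<mu> k\<bar>) \<partial>\<nu> k) \<le> \<delta> * n + D"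
  shows "(\<lambda>n. measure (distr (Pi\<^sub>M UNIV \<nu>) borel (\<lambda>y. \<Sum>k<n. y k)) {..sqrt (B n) * x + (\<Sum>k<n. \<mu> k)})
    \<longlonglongrightarrow> cdf std_normal_distribution x"
proof -
  let ?P = "Pi\<^sub>M UNIV \<nu>"
  interpret P: prob_space ?P by (intro prob_space_PiM prob)
  interpret N: real_distribution std_normal_distribution by (rule real_dist_normal_dist)
  define X where "X k y = y k - \<mu> k" for k and y :: "nat \<Rightarrow> real"
  have comp[measurable]: "(\<lambda>y. y k) \<in> ?P \<rightarrow>\<^sub>M \<nu> k" for k by measurable
  have law: "distr ?P (\<nu> k) (\<lambda>y. y k) = \<nu> k" for k
    by (rule distr_PiM_component) (auto simp: prob)
  have int: "(\<integral>y. h (y k - \<mu> k) \<partial>?P) = (\<integral>z. h (z - \<mu> k) \<partial>\<nu> k)"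
    if [measurable]: "h \<in> borel_measurable borel" for h :: "real \<Rightarrow> real" and k
    using integral_distr[OF comp[of k], of "\<lambda>z. h (z - \<mu> k)"] by (simp add: law)
  have X_indep: "P.indep_vars (\<lambda>_. borel) X UNIV"
    unfolding X_def by (rule P.indep_vars_compose2[OF indep_vars_PiM_components[OF prob]]) auto
  have X_sq: "integrable ?P (\<lambda>y. (X k y)\<^sup>2)" for k
    unfolding X_def using sq_int[of k]
    by (subst (asm) law[symmetric], subst (asm) integrable_distr_eq[OF comp]) auto
  have X_mean: "P.expectation (X k) = 0" for k
    unfolding X_def using int[of "\<lambda>z. z" k] mean by simp
  have sq: "P.expectation (\<lambda>y. (X k y)\<^sup>2) = (\<integral>y. (y - \<mu> k)\<^sup>2 \<partial>\<nu> k)" for k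
    unfolding X_def using int[of "\<lambda>z. z\<^sup>2" k] by simp
  have B: "filterlim B at_top sequentially"
  proof (rule filterlim_at_top_mono)
    show "filterlim (\<lambda>n. c * real n - C) at_top sequentially" using c by real_asymp
  qed (simp add: growth)
  then have B_pos: "\<forall>\<^sub>F n in sequentially. 0 < B n" by (simp add: filterlim_at_top_dense)
  have B_nonneg: "0 \<le> B n" for n unfolding B_def by (intro sum_nonneg) simp
  have int_tail: "integrable (\<nu> k) (\<lambda>y. (y - \<mu> k)\<^sup>2 * of_bool (K < \<bar>y - \<mu> k\<bar>))" for k K
    by (rule Bochner_Integration.integrable_bound[OF sq_int[of k]]) auto
  \<comment> \<open>Lets the fixed level of \<open>tails\<close> stand in for the moving level of
    Lindeberg's condition.\<close>
  have tail_mono: "(\<integral>y. (y - \<mu> k)\<^sup>2 * of_bool (K' < \<bar>y - \<mu> k\<bar>) \<partial>\<nu> k) \<le>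
      (\<integral>y. (y - \<mu> k)\<^sup>2 * of_bool (K < \<bar>y - \<mu> k\<bar>) \<partial>\<nu> k)" if "K \<le> K'" for K K' k
    using that by (intro integral_mono int_tail) (auto intro!: mult_left_mono)
  have lindeberg: "(\<lambda>n. (\<Sum>k<n. P.expectation (\<lambda>y. (X k y)\<^sup>2 * of_bool (\<epsilon> * sqrt (B n) < \<bar>X k y\<bar>))) / (sqrt (B n))\<^sup>2) \<longlonglongrightarrow> 0"
    if \<epsilon>: "0 < \<epsilon>" for \<epsilon>
  proof -
    define r where "r n = (\<Sum>k<n. \<integral>y. (y - \<mu> k)\<^sup>2 * of_bool (\<epsilon> * sqrt (B n) < \<bar>y - \<mu> k\<bar>) \<partial>\<nu> k)" for n
    have "(\<lambda>n. r n / B n) \<longlonglongrightarrow> 0"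
    proof (rule lindeberg_ratio_tendsto_0[OF \<epsilon> c growth])
      show "0 \<le> r n" for n unfolding r_def by (intro sum_nonneg) simp
      fix \<delta> :: real assume "0 < \<delta>"
      then obtain K D where KD: "\<And>n. (\<Sum>k<n. \<integral>y. (y - \<mu> k)\<^sup>2 * of_bool (K < \<bar>y - \<mu> k\<bar>) \<partial>\<nu> k) \<le> \<delta> * n + D"
        using tails by blast
      have "r n \<le> \<delta> * n + D" if "K \<le> \<epsilon> * sqrt (B n)" for n
        unfolding r_def by (rule order_trans[OF sum_mono[OF tail_mono[OF that]] KD])
      then show "\<exists>K D. \<forall>n. K \<le> \<epsilon> * sqrt (B n) \<longrightarrow> r n \<le> \<delta> * real n + D" by blast
    qed
    moreover have "P.expectation (\<lambda>y. (X k y)\<^sup>2 * of_bool (d < \<bar>X k y\<bar>)) =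
        (\<integral>y. (y - \<mu> k)\<^sup>2 * of_bool (d < \<bar>y - \<mu> k\<bar>) \<partial>\<nu> k)" for k d
      unfolding X_def using int[of "\<lambda>z. z\<^sup>2 * of_bool (d < \<bar>z\<bar>)" k] by simp
    ultimately show ?thesis using B_nonneg by (simp add: r_def)
  qed
  have B_X: "(\<Sum>k<n. P.expectation (\<lambda>y. (X k y)\<^sup>2)) = B n" for n
    unfolding B_def sq ..
  have "weak_conv_m (\<lambda>n. distr ?P borel (\<lambda>y. (\<Sum>k<n. X k y) / sqrt (B n))) std_normal_distribution"
    by (rule P.lindeberg_central_limit_theorem[of X, unfolded B_X, OF X_indep X_sq X_mean _ lindeberg])
      (use B_pos in simp_all)
  moreover have "isCont (cdf std_normal_distribution) x"
    by (simp add: N.isCont_cdf measure_std_normal_singleton)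
  ultimately have lim: "(\<lambda>n. cdf (distr ?P borel (\<lambda>y. (\<Sum>k<n. X k y) / sqrt (B n))) x) \<longlonglongrightarrow> cdf std_normal_distribution x"
    by (simp add: weak_conv_m_def weak_conv_def)
  \<comment> \<open>If \<open>B n = 0\<close> the quotient is 0 by convention and the two events may
    differ. Once \<open>0 < B n\<close>, multiplying by the scale turns one into the other.\<close>
  have "\<forall>\<^sub>F n in sequentially. cdf (distr ?P borel (\<lambda>y. (\<Sum>k<n. X k y) / sqrt (B n))) x =
      measure (distr ?P borel (\<lambda>y. \<Sum>k<n. y k)) {..sqrt (B n) * x + (\<Sum>k<n. \<mu> k)}"
    using B_pos
  proof eventually_elim
    case (elim n)
    have "(\<lambda>y. (\<Sum>k<n. X k y) / sqrt (B n)) -` {..x} = (\<lambda>y. \<Sum>k<n. y k) -` {..sqrt (B n) * x + (\<Sum>k<n. \<mu> k)}"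
      using elim by (auto simp: X_def sum_subtractf divide_le_eq mult.commute)
    moreover have "X k \<in> borel_measurable ?P" for k unfolding X_def by measurable
    ultimately show ?case
      unfolding cdf_def by (simp add: measure_distr)
  qed
  then show ?thesis using lim by (rule Lim_transform_eventually[rotated])
qed

section \<open>The many-to-one formula\<close>

definition rvec_mean :: "rvec measure \<Rightarrow> ennreal" where
  "rvec_mean \<rho> = (\<integral>\<^sup>+ r. of_nat (fst r) \<partial>\<rho>)"

text \<open>The law of the displacement of a uniformly chosen child of a size-biased vector: biasing
  by \<open>fst r / rvec_mean \<rho>\<close> and then choosing one of \<open>fst r\<close> children
  leaves the same weight on every pair of a vector and one of its children.\<close>

definition displacement_law :: "rvec measure \<Rightarrow> real measure" where
  "displacement_law \<rho> =
     distr (density (\<rho> \<Otimes>\<^sub>M count_space UNIV) (\<lambda>(r, i). indicator {..<fst r} i / rvec_mean \<rho>))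
       borel (\<lambda>(r, i). snd r i)"

section \<open>Measurability and integration of sums over a random number of children\<close>

lemma measurable_rvec_fst[measurable]: "fst \<in> rvec_space \<rightarrow>\<^sub>M count_space UNIV"
  unfolding rvec_space_def by measurable

lemma measurable_rvec_snd[measurable]: "(\<lambda>r. snd r i) \<in> rvec_space \<rightarrow>\<^sub>M borel"
  unfolding rvec_space_def by measurable

lemma measurable_rvec_index:
  "(\<lambda>(r, i). snd r i) \<in> rvec_space \<Otimes>\<^sub>M count_space (UNIV :: nat set) \<rightarrow>\<^sub>M borel"
proof -
  have "(\<lambda>p :: rvec \<times> nat. snd (fst p) (snd p)) \<in> rvec_space \<Otimes>\<^sub>M count_space UNIV \<rightarrow>\<^sub>M borel"
    by (rule measurable_compose_countable[where f = "\<lambda>i p. snd (fst p) i" and g = snd])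
       (auto intro: measurable_compose[OF _ measurable_rvec_snd])
  then show ?thesis by (simp add: split_beta')
qed

lemma rvec_index_less_measurable[measurable]:
  "(\<lambda>(r, i). indicator {..<fst r} i :: ennreal) \<in> borel_measurable (rvec_space \<Otimes>\<^sub>M count_space (UNIV :: nat set))"
proof -
  have "(\<lambda>p :: rvec \<times> nat. of_bool (snd p < fst (fst p)) :: ennreal)
      \<in> borel_measurable (rvec_space \<Otimes>\<^sub>M count_space UNIV)"
    by (rule measurable_compose_countable[where f = "\<lambda>i p. of_bool (i < fst (fst p))" and g = snd])
       (auto intro: measurable_compose[OF measurable_compose[OF measurable_fst measurable_rvec_fst]])
  then show ?thesis by (simp add: split_beta' indicator_def of_bool_def)
qed

lemma measurable_rvec_sum:
  fixes f :: "nat \<Rightarrow> 'b \<Rightarrow> 'c :: {second_countable_topology, topological_comm_monoid_add}"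
  assumes N[measurable]: "N \<in> K \<rightarrow>\<^sub>M count_space UNIV" and [measurable]: "\<And>i. f i \<in> borel_measurable K"
  shows "(\<lambda>r. \<Sum>i<N r. f i r) \<in> borel_measurable K"
  by (rule measurable_compose_countable[where f = "\<lambda>n r. \<Sum>i<n. f i r", OF _ N]) measurable

lemma nn_integral_displacement_law:
  assumes sets[measurable_cong]: "sets \<rho> = sets rvec_space"
    and f[measurable]: "f \<in> borel_measurable borel"
  shows "(\<integral>\<^sup>+ y. f y \<partial>displacement_law \<rho>) = (\<integral>\<^sup>+ r. (\<Sum>i<fst r. f (snd r i)) \<partial>\<rho>) / rvec_mean \<rho>"
proof -
  interpret sigma_finite_measure "count_space (UNIV :: nat set)"
    by (rule sigma_finite_measure_count_space)
  note measurable_rvec_index[measurable]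
  have "(\<integral>\<^sup>+ y. f y \<partial>displacement_law \<rho>) =
      (\<integral>\<^sup>+ p. (case p of (r, i) \<Rightarrow> indicator {..<fst r} i / rvec_mean \<rho>) *
        f (case p of (r, i) \<Rightarrow> snd r i) \<partial>(\<rho> \<Otimes>\<^sub>M count_space UNIV))"
    unfolding displacement_law_def by (subst nn_integral_distr, measurable, subst nn_integral_density) (auto simp: split_beta')
  also have "\<dots> = (\<integral>\<^sup>+ r. \<integral>\<^sup>+ i. indicator {..<fst r} i / rvec_mean \<rho> * f (snd r i) \<partial>count_space UNIV \<partial>\<rho>)"
    by (subst nn_integral_fst[symmetric]) (auto simp: split_beta')
  also have "\<dots> = (\<integral>\<^sup>+ r. (\<Sum>i<fst r. f (snd r i)) / rvec_mean \<rho> \<partial>\<rho>)"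
  proof (rule nn_integral_cong)
    fix r :: rvec
    have "(\<integral>\<^sup>+ i. indicator {..<fst r} i / rvec_mean \<rho> * f (snd r i) \<partial>count_space UNIV)
        = (\<integral>\<^sup>+ i. f (snd r i) / rvec_mean \<rho> * indicator {..<fst r} i \<partial>count_space UNIV)"
      by (intro nn_integral_cong) (auto split: split_indicator simp: divide_ennreal_def mult.commute)
    also have "\<dots> = (\<Sum>i<fst r. f (snd r i) / rvec_mean \<rho>)"
      by (simp add: nn_integral_count_space_indicator[symmetric] nn_integral_count_space_finite)
    also have "\<dots> = (\<Sum>i<fst r. f (snd r i)) / rvec_mean \<rho>"
      by (simp add: divide_ennreal_def sum_distrib_right)
    finally show "(\<integral>\<^sup>+ i. indicator {..<fst r} i / rvec_mean \<rho> * f (snd r i) \<partial>count_space UNIV) = \<dots>" .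
  qed
  also have "\<dots> = (\<integral>\<^sup>+ r. (\<Sum>i<fst r. f (snd r i)) \<partial>\<rho>) / rvec_mean \<rho>"
    by (rule nn_integral_divide, rule measurable_rvec_sum) measurable
  finally show ?thesis .
qed

lemma sets_displacement_law[simp, measurable_cong]: "sets (displacement_law \<rho>) = sets borel"
  by (simp add: displacement_law_def)

lemma prob_space_displacement_law:
  assumes "sets \<rho> = sets rvec_space" "0 < rvec_mean \<rho>" "rvec_mean \<rho> < \<infinity>"
  shows "prob_space (displacement_law \<rho>)"
proof
  show "emeasure (displacement_law \<rho>) (space (displacement_law \<rho>)) = 1"
    using nn_integral_displacement_law[OF assms(1), of "\<lambda>_. 1"] assms(2,3)
    by (simp add: rvec_mean_def[symmetric] ennreal_divide_self)
qed

text \<open>The product of indicators says that every letter of \<open>u\<close> is an admissible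
  child number, so the sum can run over all words and Tonelli applies. The induction removes the
  last generation: averaging \<open>f\<close> over the last displacement produces another test
  function, which is why \<open>f\<close> has to be arbitrary.\<close>

lemma many_to_one_paths:
  fixes f :: "real \<Rightarrow> ennreal"
  assumes prob: "\<And>k. prob_space (\<rho> k)" and sets[measurable_cong]: "\<And>k. sets (\<rho> k) = sets rvec_space"
    and mean: "\<And>k. 0 < rvec_mean (\<rho> k)" "\<And>k. rvec_mean (\<rho> k) < \<infinity>"
    and f: "f \<in> borel_measurable borel"
  shows "(\<integral>\<^sup>+ u. (\<integral>\<^sup>+ \<omega>. (\<Prod>k<n. indicator {..<fst (\<omega> k)} (u ! k)) * f (\<Sum>k<n. snd (\<omega> k) (u ! k))
        \<partial>Pi\<^sub>M {..<n} \<rho>) \<partial>count_space {u. length u = n})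
    = (\<Prod>k<n. rvec_mean (\<rho> k)) * (\<integral>\<^sup>+ y. f (\<Sum>k<n. y k) \<partial>Pi\<^sub>M {..<n} (\<lambda>k. displacement_law (\<rho> k)))"
  using f
proof (induction n arbitrary: f)
  case 0
  have "{u :: nat list. length u = 0} = {[]}" by auto
  then show ?case by (simp add: nn_integral_count_space_finite PiM_empty)
next
  case (Suc n)
  note [measurable] = Suc.prems
  let ?\<nu> = "\<lambda>k. displacement_law (\<rho> k)"
  interpret \<rho>: prob_space "\<rho> k" for k by fact
  interpret \<nu>: prob_space "?\<nu> k" for k by (rule prob_space_displacement_law) fact+
  interpret P\<rho>: product_sigma_finite \<rho> by standard
  interpret P\<nu>: product_sigma_finite ?\<nu> by standard
  define F where "F c = (\<integral>\<^sup>+ z. f (c + z) \<partial>?\<nu> n)" for c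
  have [measurable]: "F \<in> borel_measurable borel"
    unfolding F_def by measurable
  let ?g = "\<lambda>u \<omega> n f. (\<Prod>k<n. indicator {..<fst (\<omega> k)} (u ! k)) * f (\<Sum>k<n. snd (\<omega> k) (u ! k) :: real) :: ennreal"
  let ?G = "\<lambda>u. \<integral>\<^sup>+ \<omega>. ?g u \<omega> (Suc n) f \<partial>Pi\<^sub>M {..<Suc n} \<rho>"
  have meas_g: "(\<lambda>\<omega>. ?g u \<omega> m h) \<in> borel_measurable (Pi\<^sub>M {..<m} \<rho>)"
    if [measurable]: "h \<in> borel_measurable borel" for u m h
  proof -
    have [measurable]: "(\<lambda>\<omega>. snd (\<omega> k) (u ! k)) \<in> borel_measurable (Pi\<^sub>M {..<m} \<rho>)" if "k < m" for k
      using that by (intro measurable_compose[OF _ measurable_rvec_snd]) measurable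
    have [measurable]: "(\<lambda>\<omega>. indicator {..<fst (\<omega> k)} (u ! k) :: ennreal) \<in> borel_measurable (Pi\<^sub>M {..<m} \<rho>)"
      if "k < m" for k
    proof -
      have ind: "(\<lambda>r. indicator {..<fst r} (u ! k) :: ennreal) \<in> borel_measurable rvec_space"
        by measurable
      show ?thesis using that by (intro measurable_compose[OF _ ind]) measurable
    qed
    show ?thesis by measurable
  qed
  \<comment> \<open>\<open>H i\<close> is the contribution of child i in the last generation. Summed
    over i it becomes \<open>F\<close> times the mean offspring, since the displacement law is
    normalized by that mean.\<close>
  define H where "H i c = (\<integral>\<^sup>+ r. indicator {..<fst r} i * f (c + snd r i) \<partial>\<rho> n)" for i c
  have ind[measurable]: "(\<lambda>r. indicator {..<fst r} i :: ennreal) \<in> borel_measurable rvec_space" for i :: nat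
    by measurable
  have H_measurable: "H i \<in> borel_measurable borel" for i
    unfolding H_def by measurable
  have split: "?G (v @ [i]) = (\<integral>\<^sup>+ \<omega>. ?g v \<omega> n (H i) \<partial>Pi\<^sub>M {..<n} \<rho>)"
    if v: "length v = n" for v i
  proof -
    have "?G (v @ [i]) = (\<integral>\<^sup>+ \<omega>. \<integral>\<^sup>+ r. ?g (v @ [i]) (fun_upd \<omega> n r) (Suc n) f \<partial>\<rho> n \<partial>Pi\<^sub>M {..<n} \<rho>)"
      unfolding lessThan_Suc
      by (rule P\<rho>.product_nn_integral_insert) (use meas_g[of f "v @ [i]" "Suc n"] in \<open>auto simp: lessThan_Suc\<close>)
    also have "\<dots> = (\<integral>\<^sup>+ \<omega>. ?g v \<omega> n (H i) \<partial>Pi\<^sub>M {..<n} \<rho>)"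
      unfolding H_def using v
      by (intro nn_integral_cong, subst nn_integral_cmult[symmetric]) (auto simp: nth_append mult.assoc)
    finally show ?thesis .
  qed
  have sum_H: "(\<integral>\<^sup>+ i. H i c \<partial>count_space UNIV) = rvec_mean (\<rho> n) * F c" for c
  proof -
    have "(\<integral>\<^sup>+ i. H i c \<partial>count_space UNIV)
        = (\<integral>\<^sup>+ r. (\<integral>\<^sup>+ i. indicator {..<fst r} i * f (c + snd r i) \<partial>count_space UNIV) \<partial>\<rho> n)"
      unfolding H_def by (rule nn_integral_count_space_nn_integral[symmetric]) auto
    also have "\<dots> = (\<integral>\<^sup>+ r. (\<Sum>i<fst r. f (c + snd r i)) \<partial>\<rho> n)"
      by (intro nn_integral_cong, subst mult.commute)
        (simp add: nn_integral_count_space_indicator[symmetric] nn_integral_count_space_finite)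
    also have "\<dots> = rvec_mean (\<rho> n) * F c"
      unfolding F_def using mean[of n]
      by (subst nn_integral_displacement_law[OF sets])
        (auto simp: ennreal_times_divide mult.commute[of "rvec_mean (\<rho> n)"] mult_divide_eq_ennreal)
    finally show ?thesis .
  qed
  have sum_i: "(\<integral>\<^sup>+ i. ?G (v @ [i]) \<partial>count_space UNIV) = rvec_mean (\<rho> n) * (\<integral>\<^sup>+ \<omega>. ?g v \<omega> n F \<partial>Pi\<^sub>M {..<n} \<rho>)"
    if v: "length v = n" for v
  proof -
    have "(\<integral>\<^sup>+ i. ?G (v @ [i]) \<partial>count_space UNIV)
        = (\<integral>\<^sup>+ \<omega>. (\<integral>\<^sup>+ i. ?g v \<omega> n (H i) \<partial>count_space UNIV) \<partial>Pi\<^sub>M {..<n} \<rho>)"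
      unfolding split[OF v]
      by (rule nn_integral_count_space_nn_integral[symmetric]) (auto intro: meas_g H_measurable)
    also have "\<dots> = (\<integral>\<^sup>+ \<omega>. rvec_mean (\<rho> n) * ?g v \<omega> n F \<partial>Pi\<^sub>M {..<n} \<rho>)"
      by (intro nn_integral_cong) (simp add: nn_integral_cmult sum_H mult_ac)
    also have "\<dots> = rvec_mean (\<rho> n) * (\<integral>\<^sup>+ \<omega>. ?g v \<omega> n F \<partial>Pi\<^sub>M {..<n} \<rho>)"
      by (rule nn_integral_cmult[OF meas_g]) measurable
    finally show ?thesis .
  qed
  have bij: "bij_betw (\<lambda>p. fst p @ [snd p]) ({v. length v = n} \<times> UNIV) {u :: nat list. length u = Suc n}"
    by (rule bij_betw_byWitness[where f' = "\<lambda>u. (butlast u, last u)"]) (auto simp: length_Suc_conv_rev)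
  have "(\<integral>\<^sup>+ u. ?G u \<partial>count_space {u. length u = Suc n})
      = (\<integral>\<^sup>+ p. ?G (fst p @ [snd p]) \<partial>count_space ({v. length v = n} \<times> UNIV))"
    using nn_integral_bij_count_space[OF bij, of ?G] by simp
  also have "\<dots> = (\<integral>\<^sup>+ v. \<integral>\<^sup>+ i. ?G (v @ [i]) \<partial>count_space UNIV \<partial>count_space {v. length v = n})"
    by (subst pair_measure_countable[symmetric], simp, simp, subst sigma_finite_measure.nn_integral_fst[symmetric])
      (auto intro: sigma_finite_measure_count_space simp: pair_measure_countable)
  also have "\<dots> = rvec_mean (\<rho> n) * (\<integral>\<^sup>+ v. (\<integral>\<^sup>+ \<omega>. ?g v \<omega> n F \<partial>Pi\<^sub>M {..<n} \<rho>) \<partial>count_space {v. length v = n})"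
    using sum_i by (subst nn_integral_cmult[symmetric]) (auto intro!: nn_integral_cong)
  also have "\<dots> = rvec_mean (\<rho> n) * ((\<Prod>k<n. rvec_mean (\<rho> k)) * (\<integral>\<^sup>+ y. F (\<Sum>k<n. y k) \<partial>Pi\<^sub>M {..<n} ?\<nu>))"
    by (subst Suc.IH) auto
  also have "(\<integral>\<^sup>+ y. F (\<Sum>k<n. y k) \<partial>Pi\<^sub>M {..<n} ?\<nu>) = (\<integral>\<^sup>+ y. f (\<Sum>k<Suc n. y k) \<partial>Pi\<^sub>M {..<Suc n} ?\<nu>)"
    unfolding lessThan_Suc F_def
    by (subst P\<nu>.product_nn_integral_insert) (auto intro!: nn_integral_cong simp: add.commute)
  finally show ?case by (simp add: mult_ac)
qed

section \<open>From the random tree to its paths\<close>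

lemma mem_generation_iff:
  "u \<in> generation X n \<longleftrightarrow> length u = n \<and> (\<forall>k<n. u ! k < offspring X (take k u))"
proof (induction n arbitrary: u)
  case (Suc n)
  show ?case
  proof (cases u rule: rev_cases)
    case (snoc v i)
    show ?thesis unfolding snoc by (auto simp: Suc nth_append less_Suc_eq)
  qed (auto simp: Suc)
qed auto

text \<open>Presence of a particle is a condition on each proper prefix separately, hence a product
  of indicators. The sum over a random set thus becomes one over a fixed countable set, which can be
  exchanged with the quenched expectation.\<close>

lemma emeasure_counting_measure:
  assumes A: "A \<in> sets borel"
  shows "emeasure (counting_measure X n) A =
    (\<integral>\<^sup>+ u. (\<Prod>k<n. indicator {..<fst (X (take k u))} (u ! k)) *
      indicator A (\<Sum>k<n. snd (X (take k u)) (u ! k)) \<partial>count_space {u. length u = n})"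
proof -
  have "emeasure (counting_measure X n) A = (\<integral>\<^sup>+ z. indicator A z \<partial>counting_measure X n)"
    using A by (simp add: counting_measure_def)
  also have "\<dots> = (\<integral>\<^sup>+ u. indicator A (position X u) \<partial>count_space (generation X n))"
    unfolding counting_measure_def using A by (subst nn_integral_distr) auto
  also have "\<dots> = (\<integral>\<^sup>+ u. indicator A (position X u) * indicator (generation X n) u \<partial>count_space UNIV)"
    by (simp add: nn_integral_count_space_indicator)
  also have "\<dots> = (\<integral>\<^sup>+ u. (\<Prod>k<n. indicator {..<fst (X (take k u))} (u ! k)) *
      indicator A (\<Sum>k<n. snd (X (take k u)) (u ! k)) * indicator {u. length u = n} u \<partial>count_space UNIV)"
  proof (rule nn_integral_cong)
    fix u
    show "indicator A (position X u) * indicator (generation X n) u =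
      (\<Prod>k<n. indicator {..<fst (X (take k u))} (u ! k)) *
      (indicator A (\<Sum>k<n. snd (X (take k u)) (u ! k)) :: ennreal) * indicator {u. length u = n} u"
    proof (cases "length u = n")
      case True
      have "(\<Prod>k<n. indicator {..<fst (X (take k u))} (u ! k)) =
          (of_bool (\<forall>k<n. u ! k < offspring X (take k u)) :: ennreal)"
        by (auto simp: offspring_def indicator_def intro!: prod.neutral)
      then show ?thesis using True
        by (simp add: position_def displacement_def indicator_def mem_generation_iff)
    qed (simp add: mem_generation_iff)
  qed
  also have "\<dots> = (\<integral>\<^sup>+ u. (\<Prod>k<n. indicator {..<fst (X (take k u))} (u ! k)) *
      indicator A (\<Sum>k<n. snd (X (take k u)) (u ! k)) \<partial>count_space {u. length u = n})"
    by (simp add: nn_integral_count_space_indicator)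
  finally show ?thesis .
qed

text \<open>The proper prefixes of a word of length n are distinct particles, one in each generation
  below n. The vectors along the path are therefore independent, and their joint law is the same for
  all words of that length.\<close>

lemma many_to_one:
  assumes eta: "\<eta> \<in> \<Theta> \<rightarrow>\<^sub>M prob_algebra rvec_space" and s: "s \<in> space (\<Pi>\<^sub>M n\<in>UNIV. \<Theta>)"
    and mean: "\<And>k. 0 < rvec_mean (\<eta> (s k))" "\<And>k. rvec_mean (\<eta> (s k)) < \<infinity>"
    and A[measurable]: "A \<in> sets borel"
  shows "quenched_intensity \<eta> s n A = (\<Prod>k<n. rvec_mean (\<eta> (s k))) *
    emeasure (distr (\<Pi>\<^sub>M k\<in>UNIV. displacement_law (\<eta> (s k))) borel (\<lambda>y. \<Sum>k<n. y k)) A"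
proof -
  let ?\<rho> = "\<lambda>k. \<eta> (s k)" and ?\<nu> = "\<lambda>k. displacement_law (\<eta> (s k))"
  note law = prob_space_rvec_law[OF eta s]
  note [measurable_cong] = law(2)
  let ?g = "\<lambda>u \<omega>. (\<Prod>k<n. indicator {..<fst (\<omega> k)} (u ! k)) * indicator A (\<Sum>k<n. snd (\<omega> k) (u ! k) :: real) :: ennreal"
  let ?path = "\<lambda>u X. \<lambda>k\<in>{..<n}. X (take k u)"
  have g: "?g u \<in> borel_measurable (Pi\<^sub>M {..<n} ?\<rho>)" for u
  proof -
    have [measurable]: "(\<lambda>\<omega>. snd (\<omega> k) (u ! k)) \<in> borel_measurable (Pi\<^sub>M {..<n} ?\<rho>)" if "k < n" for k
      using that by (intro measurable_compose[OF _ measurable_rvec_snd]) measurable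
    have ind: "(\<lambda>r. indicator {..<fst r} i :: ennreal) \<in> borel_measurable rvec_space" for i :: nat
      by measurable
    have [measurable]: "(\<lambda>\<omega>. indicator {..<fst (\<omega> k)} (u ! k) :: ennreal) \<in> borel_measurable (Pi\<^sub>M {..<n} ?\<rho>)"
      if "k < n" for k
      using that by (intro measurable_compose[OF _ ind]) measurable
    show ?thesis by measurable
  qed
  have path: "?path u \<in> quenched \<eta> s \<rightarrow>\<^sub>M Pi\<^sub>M {..<n} ?\<rho>"
    and path_law: "distr (quenched \<eta> s) (Pi\<^sub>M {..<n} ?\<rho>) (?path u) = Pi\<^sub>M {..<n} ?\<rho>"
    if u: "length u = n" for u :: "nat list"
  proof -
    have eq: "Pi\<^sub>M {..<n} (\<lambda>k. \<eta> (s (length (take k u)))) = Pi\<^sub>M {..<n} ?\<rho>"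
      using u by (intro PiM_cong) auto
    show "?path u \<in> quenched \<eta> s \<rightarrow>\<^sub>M Pi\<^sub>M {..<n} ?\<rho>"
      unfolding quenched_def eq[symmetric]
      by (intro measurable_restrict measurable_component_singleton) auto
    have "inj_on (\<lambda>k. take k u) {..<n}"
      using u by (auto intro!: inj_onI dest: arg_cong[where f=length])
    then show "distr (quenched \<eta> s) (Pi\<^sub>M {..<n} ?\<rho>) (?path u) = Pi\<^sub>M {..<n} ?\<rho>"
      unfolding quenched_def eq[symmetric]
      by (intro distr_PiM_reindex[where M = "\<lambda>u. \<eta> (s (length u))"]) (auto simp: law)
  qed
  have g_path: "?g u (\<lambda>k. X (take k u)) = ?g u (?path u X)" for u X by simp
  have "quenched_intensity \<eta> s n A = (\<integral>\<^sup>+ X. \<integral>\<^sup>+ u. ?g u (?path u X) \<partial>count_space {u. length u = n} \<partial>quenched \<eta> s)"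
    unfolding quenched_intensity_def emeasure_counting_measure[OF A] by simp
  also have "\<dots> = (\<integral>\<^sup>+ u. \<integral>\<^sup>+ X. ?g u (?path u X) \<partial>quenched \<eta> s \<partial>count_space {u. length u = n})"
    using g path by (intro nn_integral_count_space_nn_integral measurable_compose[OF path g]) auto
  also have "\<dots> = (\<integral>\<^sup>+ u. \<integral>\<^sup>+ \<omega>. ?g u \<omega> \<partial>Pi\<^sub>M {..<n} ?\<rho> \<partial>count_space {u. length u = n})"
  proof (rule nn_integral_cong)
    fix u :: "nat list" assume "u \<in> space (count_space {u. length u = n})"
    then have u: "length u = n" by simp
    show "(\<integral>\<^sup>+ X. ?g u (?path u X) \<partial>quenched \<eta> s) = (\<integral>\<^sup>+ \<omega>. ?g u \<omega> \<partial>Pi\<^sub>M {..<n} ?\<rho>)"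
      by (subst path_law[OF u, symmetric], rule nn_integral_distr[OF path[OF u], symmetric]) (simp add: g)
  qed
  also have "\<dots> = (\<Prod>k<n. rvec_mean (?\<rho> k)) * (\<integral>\<^sup>+ y. indicator A (\<Sum>k<n. y k) \<partial>Pi\<^sub>M {..<n} ?\<nu>)"
    using law mean by (intro many_to_one_paths) auto
  \<comment> \<open>The infinite product carries the sums for all n on one probability space, as the
    central limit theorem requires.\<close>
  also have "Pi\<^sub>M {..<n} ?\<nu> = distr (Pi\<^sub>M UNIV ?\<nu>) (Pi\<^sub>M {..<n} ?\<nu>) (\<lambda>y. \<lambda>k\<in>{..<n}. y k)"
    using prob_space_displacement_law[OF law(2) mean]
    by (intro distr_PiM_reindex[where f = "\<lambda>k. k", symmetric]) auto
  also have "(\<integral>\<^sup>+ y. indicator A (\<Sum>k<n. y k) \<partial>\<dots>) = (\<integral>\<^sup>+ y. indicator A (\<Sum>k<n. y k) \<partial>Pi\<^sub>M UNIV ?\<nu>)"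
    by (subst nn_integral_distr) measurable
  also have "\<dots> = (\<integral>\<^sup>+ z. indicator A z \<partial>distr (Pi\<^sub>M UNIV ?\<nu>) borel (\<lambda>y. \<Sum>k<n. y k))"
    by (subst nn_integral_distr) measurable
  also have "\<dots> = emeasure (distr (Pi\<^sub>M UNIV ?\<nu>) borel (\<lambda>y. \<Sum>k<n. y k)) A"
    by simp
  finally show ?thesis .
qed

section \<open>Moments of the displacement law\<close>

definition rvec_barycenter :: "rvec measure \<Rightarrow> real" where
  "rvec_barycenter \<rho> = (\<integral>r. (\<Sum>i<fst r. snd r i) \<partial>\<rho>) / enn2real (rvec_mean \<rho>)"

definition rvec_tail_variance :: "real \<Rightarrow> rvec measure \<Rightarrow> ennreal" where
  "rvec_tail_variance K \<rho> = (\<integral>\<^sup>+ y. ennreal ((y - rvec_barycenter \<rho>)\<^sup>2 * of_bool (K < \<bar>y - rvec_barycenter \<rho>\<bar>))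
     \<partial>displacement_law \<rho>)"

text \<open>The threshold -1 makes the indicator trivial.\<close>

abbreviation rvec_variance :: "rvec measure \<Rightarrow> ennreal" where
  "rvec_variance \<rho> \<equiv> rvec_tail_variance (- 1) \<rho>"

lemma rvec_variance_eq:
  "rvec_variance \<rho> = (\<integral>\<^sup>+ y. ennreal ((y - rvec_barycenter \<rho>)\<^sup>2) \<partial>displacement_law \<rho>)"
proof -
  have "-1 < \<bar>z\<bar>" for z :: real by (rule less_le_trans[of _ 0]) auto
  then show ?thesis by (simp add: rvec_tail_variance_def)
qed

lemma rvec_tail_variance_le: "rvec_tail_variance K \<rho> \<le> rvec_variance \<rho>"
  unfolding rvec_variance_eq unfolding rvec_tail_variance_def by (intro nn_integral_mono) auto

text \<open>The formula is known for nonnegative integrands. That case also carries integrability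
  from the displacement law over to the sum over the children, so the positive and negative parts
  may be subtracted.\<close>

lemma integral_displacement_law:
  fixes f :: "real \<Rightarrow> real"
  assumes sets[measurable_cong]: "sets \<rho> = sets rvec_space"
    and mean: "0 < rvec_mean \<rho>" "rvec_mean \<rho> < \<infinity>"
    and f: "integrable (displacement_law \<rho>) f"
  shows "(\<integral>y. f y \<partial>displacement_law \<rho>) = (\<integral>r. (\<Sum>i<fst r. f (snd r i)) \<partial>\<rho>) / enn2real (rvec_mean \<rho>)"
proof -
  have [measurable]: "f \<in> borel_measurable borel"
    using borel_measurable_integrable[OF f] by (simp cong: measurable_cong_sets)
  let ?m = "rvec_mean \<rho>"
  have nonneg: "integrable \<rho> (\<lambda>r. \<Sum>i<fst r. g (snd r i)) \<and>
      (\<integral>r. (\<Sum>i<fst r. g (snd r i)) \<partial>\<rho>) = enn2real ?m * (\<integral>y. g y \<partial>displacement_law \<rho>)"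
    if g: "integrable (displacement_law \<rho>) g" and [measurable]: "g \<in> borel_measurable borel"
      and g0: "\<And>y. 0 \<le> g y" for g :: "real \<Rightarrow> real"
  proof -
    have [measurable]: "(\<lambda>r. \<Sum>i<fst r. g (snd r i)) \<in> borel_measurable \<rho>"
      by (rule measurable_rvec_sum) measurable
    have "(\<integral>\<^sup>+ r. (\<Sum>i<fst r. ennreal (g (snd r i))) \<partial>\<rho>) = ?m * (\<integral>\<^sup>+ y. ennreal (g y) \<partial>displacement_law \<rho>)"
      using mean by (subst nn_integral_displacement_law[OF sets])
        (auto simp: ennreal_times_divide mult.commute[of ?m] mult_divide_eq_ennreal)
    then have eq: "(\<integral>\<^sup>+ r. ennreal (\<Sum>i<fst r. g (snd r i)) \<partial>\<rho>) = ?m * ennreal (\<integral>y. g y \<partial>displacement_law \<rho>)"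
      using g g0 by (simp add: nn_integral_eq_integral g0)
    have "integrable \<rho> (\<lambda>r. \<Sum>i<fst r. g (snd r i))"
      using mean g0 by (intro integrableI_nonneg) (auto simp: eq ennreal_mult_less_top intro!: sum_nonneg)
    moreover have "(\<integral>r. (\<Sum>i<fst r. g (snd r i)) \<partial>\<rho>) = enn2real ?m * (\<integral>y. g y \<partial>displacement_law \<rho>)"
      using g0 by (subst integral_eq_nn_integral) (auto simp: eq enn2real_mult intro!: sum_nonneg)
    ultimately show ?thesis by blast
  qed
  let ?p = "\<lambda>y. max 0 (f y)" and ?q = "\<lambda>y. max 0 (- f y)"
  have pq: "integrable (displacement_law \<rho>) ?p" "integrable (displacement_law \<rho>) ?q"
    using f by auto
  have f_eq: "f y = ?p y - ?q y" for y by (auto simp: max_def)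
  have "(\<integral>r. (\<Sum>i<fst r. f (snd r i)) \<partial>\<rho>) = (\<integral>r. (\<Sum>i<fst r. ?p (snd r i)) - (\<Sum>i<fst r. ?q (snd r i)) \<partial>\<rho>)"
    by (subst sum_subtractf[symmetric], subst f_eq) simp
  also have "\<dots> = enn2real ?m * ((\<integral>y. ?p y \<partial>displacement_law \<rho>) - (\<integral>y. ?q y \<partial>displacement_law \<rho>))"
    using nonneg[OF pq(1)] nonneg[OF pq(2)] by (simp add: right_diff_distrib)
  also have "(\<integral>y. ?p y \<partial>displacement_law \<rho>) - (\<integral>y. ?q y \<partial>displacement_law \<rho>) = (\<integral>y. f y \<partial>displacement_law \<rho>)"
    using pq by (subst Bochner_Integration.integral_diff[symmetric]) (auto simp flip: f_eq)
  finally show ?thesis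
    using mean by (auto simp: enn2real_eq_0_iff)
qed

text \<open>
  The Bochner integral in \<^const>\<open>rvec_barycenter\<close> might a priori be a junk value. But a finite second
  moment about any real number makes the displacement law integrable, so this integral is genuine.
\<close>

lemma displacement_law_centered:
  assumes sets: "sets \<rho> = sets rvec_space"
    and mean: "0 < rvec_mean \<rho>" "rvec_mean \<rho> < \<infinity>" and var: "rvec_variance \<rho> < \<infinity>"
  shows "integrable (displacement_law \<rho>) (\<lambda>y. (y - rvec_barycenter \<rho>)\<^sup>2)"
    and "(\<integral>y. y - rvec_barycenter \<rho> \<partial>displacement_law \<rho>) = 0"
    and "(\<integral>y. (y - rvec_barycenter \<rho>)\<^sup>2 \<partial>displacement_law \<rho>) = enn2real (rvec_variance \<rho>)"
    and "(\<integral>y. (y - rvec_barycenter \<rho>)\<^sup>2 * of_bool (K < \<bar>y - rvec_barycenter \<rho>\<bar>) \<partial>displacement_law \<rho>)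
      = enn2real (rvec_tail_variance K \<rho>)"
proof -
  interpret prob_space "displacement_law \<rho>"
    by (rule prob_space_displacement_law[OF sets mean])
  show sq: "integrable (displacement_law \<rho>) (\<lambda>y. (y - rvec_barycenter \<rho>)\<^sup>2)"
    using var by (intro integrableI_nonneg) (auto simp: rvec_variance_eq)
  have "integrable (displacement_law \<rho>) (\<lambda>y. y - rvec_barycenter \<rho>)"
    by (rule square_integrable_imp_integrable[OF _ sq]) measurable
  from Bochner_Integration.integrable_add[OF this integrable_const[of "rvec_barycenter \<rho>"]]
  have y: "integrable (displacement_law \<rho>) (\<lambda>y. y)" by simp
  \<comment> \<open>For the identity function the integral formula gives precisely the quotient that
    defines the barycenter.\<close>
  then show "(\<integral>y. y - rvec_barycenter \<rho> \<partial>displacement_law \<rho>) = 0"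
    using integral_displacement_law[OF sets mean y]
    by (simp add: rvec_barycenter_def prob_space)
  show "(\<integral>y. (y - rvec_barycenter \<rho>)\<^sup>2 \<partial>displacement_law \<rho>) = enn2real (rvec_variance \<rho>)"
    unfolding rvec_variance_eq by (rule integral_eq_nn_integral) auto
  show "(\<integral>y. (y - rvec_barycenter \<rho>)\<^sup>2 * of_bool (K < \<bar>y - rvec_barycenter \<rho>\<bar>) \<partial>displacement_law \<rho>)
      = enn2real (rvec_tail_variance K \<rho>)"
    unfolding rvec_tail_variance_def by (rule integral_eq_nn_integral) auto
qed

lemma rvec_tail_variance_tendsto_0:
  assumes "rvec_variance \<rho> < \<infinity>"
  shows "(\<lambda>K::nat. rvec_tail_variance K \<rho>) \<longlonglongrightarrow> 0"
proof -
  let ?h = "\<lambda>(K::nat) y. ennreal ((y - rvec_barycenter \<rho>)\<^sup>2 * of_bool (K < \<bar>y - rvec_barycenter \<rho>\<bar>))"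
  have "(\<lambda>K. \<integral>\<^sup>+ y. ?h K y \<partial>displacement_law \<rho>) \<longlonglongrightarrow> (\<integral>\<^sup>+ y. 0 \<partial>displacement_law \<rho>)"
  proof (rule nn_integral_dominated_convergence[where w = "\<lambda>y. ennreal ((y - rvec_barycenter \<rho>)\<^sup>2)"])
    show "AE y in displacement_law \<rho>. (\<lambda>K. ?h K y) \<longlonglongrightarrow> 0"
    proof (rule AE_I2)
      fix y
      obtain k :: nat where "\<bar>y - rvec_barycenter \<rho>\<bar> \<le> k" using real_arch_simple by blast
      then have "\<forall>\<^sub>F K in sequentially. ?h K y = 0"
        by (intro eventually_sequentiallyI[of k]) auto
      then show "(\<lambda>K. ?h K y) \<longlonglongrightarrow> 0" by (rule tendsto_eventually)
    qed
  qed (use assms in \<open>auto simp: rvec_variance_eq\<close>)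
  then show ?thesis by (simp add: rvec_tail_variance_def)
qed

section \<open>The quenched limit theorem\<close>

lemma quenched_component:
  fixes f :: "rvec \<Rightarrow> ennreal" and g :: "rvec \<Rightarrow> real"
  assumes eta: "\<eta> \<in> \<Theta> \<rightarrow>\<^sub>M prob_algebra rvec_space" and s: "s \<in> space (\<Pi>\<^sub>M n\<in>UNIV. \<Theta>)"
  shows "f \<in> borel_measurable rvec_space \<Longrightarrow>
      (\<integral>\<^sup>+ X. f (X u) \<partial>quenched \<eta> s) = (\<integral>\<^sup>+ r. f r \<partial>\<eta> (s (length u)))" (is "_ \<Longrightarrow> ?f")
    and "g \<in> borel_measurable rvec_space \<Longrightarrow>
      (\<integral>X. g (X u) \<partial>quenched \<eta> s) = (\<integral>r. g r \<partial>\<eta> (s (length u)))" (is "_ \<Longrightarrow> ?g")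
proof -
  note [measurable_cong] = prob_space_rvec_law(2)[OF eta s]
  have comp: "(\<lambda>X. X u) \<in> quenched \<eta> s \<rightarrow>\<^sub>M \<eta> (s (length u))"
    unfolding quenched_def by (rule measurable_component_singleton) simp
  show ?f if [measurable]: "f \<in> borel_measurable rvec_space"
    using nn_integral_distr[OF comp, of f] by (simp add: distr_quenched_component[OF eta s])
  show ?g if [measurable]: "g \<in> borel_measurable rvec_space"
    using integral_distr[OF comp, of g] by (simp add: distr_quenched_component[OF eta s])
qed

lemma mean_offspring_eq:
  assumes "\<eta> \<in> \<Theta> \<rightarrow>\<^sub>M prob_algebra rvec_space" "s \<in> space (\<Pi>\<^sub>M n\<in>UNIV. \<Theta>)"
  shows "mean_offspring \<eta> s n = rvec_mean (\<eta> (s n))"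
  using quenched_component(1)[OF assms, of "\<lambda>r. of_nat (fst r)" "rep n"]
  by (simp add: mean_offspring_def rvec_mean_def offspring_def)

lemma mean_displacement_eq:
  assumes "\<eta> \<in> \<Theta> \<rightarrow>\<^sub>M prob_algebra rvec_space" "s \<in> space (\<Pi>\<^sub>M n\<in>UNIV. \<Theta>)"
  shows "mean_displacement \<eta> s n = rvec_barycenter (\<eta> (s n))"
proof -
  have "(\<lambda>r :: rvec. \<Sum>i<fst r. snd r i) \<in> borel_measurable rvec_space"
    by (rule measurable_rvec_sum) measurable
  from quenched_component(2)[OF assms this, of "rep n"] show ?thesis
    by (simp add: mean_displacement_def rvec_barycenter_def mean_offspring_eq[OF assms]
        displacement_sum_def offspring_def displacement_def)
qed

lemma var_displacement_eq:
  assumes "\<eta> \<in> \<Theta> \<rightarrow>\<^sub>M prob_algebra rvec_space" "s \<in> space (\<Pi>\<^sub>M n\<in>UNIV. \<Theta>)"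
  shows "var_displacement \<eta> s n = rvec_variance (\<eta> (s n))"
proof -
  have "(\<lambda>r :: rvec. ennreal (\<Sum>i<fst r. (snd r i - rvec_barycenter (\<eta> (s n)))\<^sup>2)) \<in> borel_measurable rvec_space"
    by (intro measurable_compose[OF _ measurable_ennreal] measurable_rvec_sum) measurable
  from quenched_component(1)[OF assms this, of "rep n"] show ?thesis
    by (simp add: var_displacement_def rvec_variance_eq mean_offspring_eq[OF assms] mean_displacement_eq[OF assms]
        offspring_def displacement_def nn_integral_displacement_law[OF prob_space_rvec_law(2)[OF assms]])
qed

section \<open>Measurable dependence on the state of the environment\<close>

lemma rvec_mean_measurable:
  assumes "\<eta> \<in> \<Theta> \<rightarrow>\<^sub>M prob_algebra rvec_space"
  shows "(\<lambda>\<theta>. rvec_mean (\<eta> \<theta>)) \<in> borel_measurable \<Theta>"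
  unfolding rvec_mean_def
  by (rule measurable_compose[OF measurable_prob_algebraD[OF assms] nn_integral_measurable_subprob_algebra]) measurable

lemma rvec_barycenter_measurable:
  assumes "\<eta> \<in> \<Theta> \<rightarrow>\<^sub>M prob_algebra rvec_space"
  shows "(\<lambda>\<theta>. rvec_barycenter (\<eta> \<theta>)) \<in> borel_measurable \<Theta>"
proof -
  note [measurable] = rvec_mean_measurable[OF assms]
  have "(\<lambda>r :: rvec. \<Sum>i<fst r. snd r i) \<in> borel_measurable rvec_space"
    by (rule measurable_rvec_sum) measurable
  from measurable_compose[OF measurable_prob_algebraD[OF assms] integral_measurable_subprob_algebra[OF this]]
  show ?thesis unfolding rvec_barycenter_def by measurable
qed

text \<open>Measurability in the state is available for integrals against the kernel
  \<open>\<eta>\<close>, so the integral over the displacement law is first written as a quotient of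
  such integrals. The integrand varies with the state through the barycenter, hence the joint
  measurability.\<close>

lemma rvec_tail_variance_measurable:
  assumes eta: "\<eta> \<in> \<Theta> \<rightarrow>\<^sub>M prob_algebra rvec_space"
  shows "(\<lambda>\<theta>. rvec_tail_variance K (\<eta> \<theta>)) \<in> borel_measurable \<Theta>"
proof -
  note [measurable] = rvec_mean_measurable[OF assms] rvec_barycenter_measurable[OF assms]
  let ?h = "\<lambda>\<theta> y. ennreal ((y - rvec_barycenter (\<eta> \<theta>))\<^sup>2 * of_bool (K < \<bar>y - rvec_barycenter (\<eta> \<theta>)\<bar>))"
  have "(\<lambda>p. \<Sum>i<fst (snd p). ?h (fst p) (snd (snd p) i)) \<in> borel_measurable (\<Theta> \<Otimes>\<^sub>M rvec_space)"
  proof (rule measurable_rvec_sum)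
    fix i
    have [measurable]: "(\<lambda>p :: _ \<times> rvec. snd (snd p) i) \<in> borel_measurable (\<Theta> \<Otimes>\<^sub>M rvec_space)"
      by (rule measurable_compose[OF measurable_snd measurable_rvec_snd])
    show "(\<lambda>p. ?h (fst p) (snd (snd p) i)) \<in> borel_measurable (\<Theta> \<Otimes>\<^sub>M rvec_space)"
      by measurable
  qed (rule measurable_compose[OF measurable_snd measurable_rvec_fst])
  then have "(\<lambda>\<theta>. \<integral>\<^sup>+ r. (\<Sum>i<fst r. ?h \<theta> (snd r i)) \<partial>\<eta> \<theta>) \<in> borel_measurable \<Theta>"
    by (intro nn_integral_measurable_subprob_algebra2[OF _ measurable_prob_algebraD[OF eta]])
       (simp add: split_beta')
  then have quotient: "(\<lambda>\<theta>. (\<integral>\<^sup>+ r. (\<Sum>i<fst r. ?h \<theta> (snd r i)) \<partial>\<eta> \<theta>) / rvec_mean (\<eta> \<theta>)) \<in> borel_measurable \<Theta>"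
    by (rule borel_measurable_divide_ennreal) measurable
  have eq: "rvec_tail_variance K (\<eta> \<theta>) = (\<integral>\<^sup>+ r. (\<Sum>i<fst r. ?h \<theta> (snd r i)) \<partial>\<eta> \<theta>) / rvec_mean (\<eta> \<theta>)"
    if "\<theta> \<in> space \<Theta>" for \<theta>
  proof -
    have "sets (\<eta> \<theta>) = sets rvec_space"
      using measurable_space[OF eta that] by (simp add: space_prob_algebra)
    then show ?thesis unfolding rvec_tail_variance_def by (intro nn_integral_displacement_law) measurable
  qed
  show ?thesis by (subst measurable_cong[OF eq], assumption, rule quotient)
qed

text \<open>The environment is a fixed sequence here; the hypotheses from \<open>mean\<close> to
  \<open>tails\<close> are what stationarity and ergodicity have to supply for almost every
  realization.\<close>

lemma quenched_clt:
  assumes eta: "\<eta> \<in> \<Theta> \<rightarrow>\<^sub>M prob_algebra rvec_space" and s: "s \<in> space (\<Pi>\<^sub>M n\<in>UNIV. \<Theta>)"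
    and mean: "\<And>k. 0 < rvec_mean (\<eta> (s k))" "\<And>k. rvec_mean (\<eta> (s k)) < \<infinity>"
    and var: "\<And>k. rvec_variance (\<eta> (s k)) < \<infinity>"
    and c: "0 < c" and growth: "\<And>n. c * real n - C \<le> (\<Sum>k<n. enn2real (rvec_variance (\<eta> (s k))))"
    and tails: "\<And>\<delta>. 0 < \<delta> \<Longrightarrow> \<exists>K D. \<forall>n. (\<Sum>k<n. enn2real (rvec_tail_variance K (\<eta> (s k)))) \<le> \<delta> * real n + D"
  shows "(\<lambda>n. enn2real (quenched_intensity \<eta> s n {..scaling \<eta> s n * x + centering \<eta> s n})
        / enn2real (quenched_intensity \<eta> s n UNIV))
      \<longlonglongrightarrow> cdf std_normal_distribution x"
proof -
  let ?\<nu> = "\<lambda>k. displacement_law (\<eta> (s k))"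
  let ?S = "\<lambda>n. distr (Pi\<^sub>M UNIV ?\<nu>) borel (\<lambda>y. \<Sum>k<n. y k)"
  let ?m = "\<lambda>n. \<Prod>k<n. rvec_mean (\<eta> (s k))"
  note law = prob_space_rvec_law[OF eta s]
  note centered = displacement_law_centered[OF law(2) mean var]
  note prob = prob_space_displacement_law[OF law(2) mean]
  interpret P: prob_space "Pi\<^sub>M UNIV ?\<nu>" by (intro prob_space_PiM prob)
  interpret S: prob_space "?S n" for n by (rule P.prob_space_distr) measurable
  have scaling: "scaling \<eta> s n = sqrt (\<Sum>k<n. enn2real (rvec_variance (\<eta> (s k))))" for n
    unfolding scaling_def var_displacement_eq[OF eta s] using var by (simp add: enn2real_sum less_top)
  have centering: "centering \<eta> s n = (\<Sum>k<n. rvec_barycenter (\<eta> (s k)))" for n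
    unfolding centering_def mean_displacement_eq[OF eta s] ..
  have m_fin: "?m n < \<infinity>" for n using mean(2) by (induction n) (auto simp: ennreal_mult_less_top)
  have m_pos: "?m n \<noteq> 0" for n using mean(1) by (simp add: prod_zero_iff less_imp_neq[symmetric])
  \<comment> \<open>The product of the means is neither 0 nor infinite, so it survives the
    conversion to reals and cancels; the law of the sum has total mass 1.\<close>
  have "enn2real (quenched_intensity \<eta> s n A) / enn2real (quenched_intensity \<eta> s n UNIV) = measure (?S n) A"
    if "A \<in> sets borel" for n A
    using m_fin[of n] m_pos[of n] that S.emeasure_space_1[of n]
    by (simp add: many_to_one[OF eta s mean] enn2real_mult enn2real_eq_0_iff measure_def)
  then have "(\<lambda>n. enn2real (quenched_intensity \<eta> s n {..scaling \<eta> s n * x + centering \<eta> s n})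
      / enn2real (quenched_intensity \<eta> s n UNIV)) =
      (\<lambda>n. measure (?S n) {..sqrt (\<Sum>k<n. enn2real (rvec_variance (\<eta> (s k)))) * x + (\<Sum>k<n. rvec_barycenter (\<eta> (s k)))})"
    by (simp add: scaling centering)
  also have "\<dots> \<longlonglongrightarrow> cdf std_normal_distribution x"
    using product_central_limit_theorem[of ?\<nu> "\<lambda>k. rvec_barycenter (\<eta> (s k))" c C x,
        OF prob _ centered(1,2), unfolded centered(3,4)] c growth tails
    by simp
  finally show ?thesis .
qed

section \<open>Stationary ergodic environments\<close>

text \<open>Each conditional law is a probability measure carried by the fibre over
  \<open>s\<close>, so integrating out the configuration leaves \<open>\<tau>\<close>. Statements
  about the environment can thus be moved between the annealed law and
  \<open>\<tau>\<close>.\<close>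

lemma distr_annealed_fst:
  assumes eta: "\<eta> \<in> \<Theta> \<rightarrow>\<^sub>M prob_algebra rvec_space"
    and prob: "prob_space \<tau>" and sets: "sets \<tau> = sets (\<Pi>\<^sub>M n\<in>UNIV. \<Theta>)"
  shows "fst \<in> annealed \<eta> \<tau> \<rightarrow>\<^sub>M \<tau>" and "distr (annealed \<eta> \<tau>) \<tau> fst = \<tau>"
proof -
  interpret prob_space \<tau> by fact
  let ?K = "\<lambda>s. distr (quenched \<eta> s) (\<tau> \<Otimes>\<^sub>M config_space) (\<lambda>X. (s, X))"
  have K: "?K \<in> \<tau> \<rightarrow>\<^sub>M subprob_algebra (\<tau> \<Otimes>\<^sub>M config_space)"
    using measurable_quenched_pair[OF eta sets] by (rule measurable_prob_algebraD)
  have sets_P: "sets (annealed \<eta> \<tau>) = sets (\<tau> \<Otimes>\<^sub>M config_space)"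
    unfolding annealed_def using K not_empty by (rule sets_bind_measurable)
  then show meas: "fst \<in> annealed \<eta> \<tau> \<rightarrow>\<^sub>M \<tau>"
    by (simp cong: measurable_cong_sets)
  show "distr (annealed \<eta> \<tau>) \<tau> fst = \<tau>"
  proof (rule measure_eqI)
    fix A assume "A \<in> sets (distr (annealed \<eta> \<tau>) \<tau> fst)"
    then have A[measurable]: "A \<in> sets \<tau>" by simp
    have "emeasure (distr (annealed \<eta> \<tau>) \<tau> fst) A = (\<integral>\<^sup>+ s. indicator A s \<partial>distr (annealed \<eta> \<tau>) \<tau> fst)"
      by simp
    also have "\<dots> = (\<integral>\<^sup>+ p. indicator A (fst p) \<partial>annealed \<eta> \<tau>)"
      by (rule nn_integral_distr[OF meas]) measurable
    also have "\<dots> = (\<integral>\<^sup>+ s. \<integral>\<^sup>+ p. indicator A (fst p) \<partial>?K s \<partial>\<tau>)"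
      unfolding annealed_def by (rule nn_integral_bind[OF _ K]) measurable
    also have "\<dots> = (\<integral>\<^sup>+ s. indicator A s \<partial>\<tau>)"
    proof (rule nn_integral_cong)
      fix s assume s: "s \<in> space \<tau>"
      then have s': "s \<in> space (\<Pi>\<^sub>M n\<in>UNIV. \<Theta>)" using sets_eq_imp_space_eq[OF sets] by simp
      have [measurable]: "(\<lambda>X. (s, X)) \<in> quenched \<eta> s \<rightarrow>\<^sub>M \<tau> \<Otimes>\<^sub>M config_space"
        using s by (simp cong: measurable_cong_sets add: sets_quenched[OF eta s'])
      show "(\<integral>\<^sup>+ p. indicator A (fst p) \<partial>?K s) = indicator A s"
        using prob_space.emeasure_space_1[OF prob_space_quenched[OF eta s']]
        by (subst nn_integral_distr) auto
    qed
    finally show "emeasure (distr (annealed \<eta> \<tau>) \<tau> fst) A = emeasure \<tau> A" by simp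
  qed simp
qed

lemma AE_annealed_iff:
  assumes "\<eta> \<in> \<Theta> \<rightarrow>\<^sub>M prob_algebra rvec_space"
    and "prob_space \<tau>" "sets \<tau> = sets (\<Pi>\<^sub>M n\<in>UNIV. \<Theta>)" and "{s \<in> space \<tau>. Q s} \<in> sets \<tau>"
  shows "(AE (s, X) in annealed \<eta> \<tau>. Q s) \<longleftrightarrow> (AE s in \<tau>. Q s)"
  using AE_distr_iff[OF distr_annealed_fst(1)[OF assms(1-3)] assms(4)]
  unfolding distr_annealed_fst(2)[OF assms(1-3)] by (simp add: split_beta')

text \<open>Preimages of null sets are null, so this direction holds for any \<open>Q\<close>, and
  the convergence event transfers without a proof of its measurability.\<close>

lemma AE_annealedI:
  assumes "\<eta> \<in> \<Theta> \<rightarrow>\<^sub>M prob_algebra rvec_space"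
    and "prob_space \<tau>" "sets \<tau> = sets (\<Pi>\<^sub>M n\<in>UNIV. \<Theta>)" and "AE s in \<tau>. Q s"
  shows "AE (s, X) in annealed \<eta> \<tau>. Q s"
  using AE_distrD[OF distr_annealed_fst(1)[OF assms(1-3)], of Q] assms(4)
  unfolding distr_annealed_fst(2)[OF assms(1-3)] by (simp add: split_beta')

lemma nn_integral_annealed:
  assumes "\<eta> \<in> \<Theta> \<rightarrow>\<^sub>M prob_algebra rvec_space"
    and "prob_space \<tau>" "sets \<tau> = sets (\<Pi>\<^sub>M n\<in>UNIV. \<Theta>)" and "f \<in> borel_measurable \<tau>"
  shows "(\<integral>\<^sup>+ (s, X). f s \<partial>annealed \<eta> \<tau>) = (\<integral>\<^sup>+ s. f s \<partial>\<tau>)"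
  using nn_integral_distr[OF distr_annealed_fst(1)[OF assms(1-3)], of f] assms(4)
  unfolding distr_annealed_fst(2)[OF assms(1-3)] by (simp add: split_beta')

section \<open>The shift on the space of environments\<close>

lemma sets_seq_law: "sets (seq_law M \<Theta> \<xi>) = sets (\<Pi>\<^sub>M n\<in>UNIV. \<Theta>)"
  by (simp add: seq_law_def)

context
  fixes M :: "'w measure" and \<Theta> :: "'e measure" and \<xi> :: "nat \<Rightarrow> 'w \<Rightarrow> 'e"
  assumes M: "prob_space M" and xi: "\<And>n. \<xi> n \<in> M \<rightarrow>\<^sub>M \<Theta>"
    and stationary: "stationary_seq M \<Theta> \<xi>"
begin

lemma measurable_sequence: "(\<lambda>\<omega> n. \<xi> n \<omega>) \<in> M \<rightarrow>\<^sub>M (\<Pi>\<^sub>M n\<in>UNIV. \<Theta>)"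
  using measurable_restrict[of UNIV \<xi> M "\<lambda>_. \<Theta>"] xi by (simp add: restrict_UNIV)

lemma prob_space_seq_law: "prob_space (seq_law M \<Theta> \<xi>)"
  unfolding seq_law_def by (rule prob_space.prob_space_distr[OF M measurable_sequence])

lemma measurable_shift: "(\<lambda>s n. s (Suc n)) \<in> seq_law M \<Theta> \<xi> \<rightarrow>\<^sub>M seq_law M \<Theta> \<xi>"
proof -
  have "(\<lambda>s. \<lambda>n\<in>UNIV. s (Suc n)) \<in> (\<Pi>\<^sub>M n\<in>UNIV. \<Theta>) \<rightarrow>\<^sub>M (\<Pi>\<^sub>M n\<in>UNIV. \<Theta>)"
    by (intro measurable_restrict measurable_component_singleton) simp
  then show ?thesis by (simp add: restrict_UNIV seq_law_def)
qed

lemma distr_shift: "distr (seq_law M \<Theta> \<xi>) (seq_law M \<Theta> \<xi>) (\<lambda>s n. s (Suc n)) = seq_law M \<Theta> \<xi>"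
proof -
  have "distr (seq_law M \<Theta> \<xi>) (seq_law M \<Theta> \<xi>) (\<lambda>s n. s (Suc n)) =
      distr (seq_law M \<Theta> \<xi>) (\<Pi>\<^sub>M n\<in>UNIV. \<Theta>) (\<lambda>s n. s (Suc n))"
    by (intro distr_cong) (auto simp: sets_seq_law)
  also have "\<dots> = distr M (\<Pi>\<^sub>M n\<in>UNIV. \<Theta>) (\<lambda>\<omega> n. \<xi> (Suc n) \<omega>)"
    unfolding seq_law_def
    using measurable_shift measurable_sequence
    by (subst distr_distr) (auto simp: o_def seq_law_def)
  also have "\<dots> = seq_law M \<Theta> \<xi>"
    using stationary unfolding stationary_seq_def seq_law_def .
  finally show ?thesis .
qed

lemma AE_stationary:
  assumes "AE s in seq_law M \<Theta> \<xi>. Q (s 0)"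
  shows "AE s in seq_law M \<Theta> \<xi>. \<forall>k. Q (s k)"
proof -
  have "AE s in seq_law M \<Theta> \<xi>. Q (s k)" for k
  proof (induction k)
    case (Suc k)
    then show ?case
      using AE_distrD[OF measurable_shift, of "\<lambda>s. Q (s k)"] unfolding distr_shift by simp
  qed (rule assms)
  then show ?thesis by (simp add: AE_all_countable)
qed

lemma ergodic_sums_bounded_above:
  fixes f :: "'e \<Rightarrow> real"
  assumes ergodic: "ergodic_seq M \<Theta> \<xi>"
    and int: "integrable (seq_law M \<Theta> \<xi>) (\<lambda>s. f (s 0))"
    and neg: "(\<integral>s. f (s 0) \<partial>seq_law M \<Theta> \<xi>) < 0"
  shows "AE s in seq_law M \<Theta> \<xi>. \<exists>C. \<forall>n. (\<Sum>k<n. f (s k)) \<le> C"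
proof -
  let ?T = "\<lambda>s n. s (Suc n) :: 'e"
  interpret prob_space "seq_law M \<Theta> \<xi>" by (rule prob_space_seq_law)
  \<comment> \<open>At n = 0 this identifies the Birkhoff sums of \<open>\<lambda>s. f (s 0)\<close>
    under the shift with the sums of \<open>f (s k)\<close>.\<close>
  have "((?T ^^ k) s) n = s (n + k)" for k s n
    by (induction k arbitrary: n) auto
  then have "(?T ^^ k) s 0 = s k" for k s by simp
  moreover have "AE s in seq_law M \<Theta> \<xi>. \<exists>C. \<forall>n. (\<Sum>k<n. f ((?T ^^ k) s 0)) \<le> C"
    using ergodic sets_eq_imp_space_eq[OF sets_seq_law, of M \<Theta> \<xi>]
    by (intro birkhoff_sums_bounded_above measurable_shift distr_shift int neg)
       (auto simp: ergodic_seq_def sets_seq_law)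
  ultimately show ?thesis by simp
qed

end

theorem theorem9p1:
  fixes M :: "'w measure" and \<Theta> :: "'e measure" and \<xi> :: "nat \<Rightarrow> 'w \<Rightarrow> 'e"
    and \<eta> :: "'e \<Rightarrow> rvec measure" and P :: "((nat \<Rightarrow> 'e) \<times> config) measure" and x :: real
  assumes M: "prob_space M"
    and xi: "\<And>n. \<xi> n \<in> M \<rightarrow>\<^sub>M \<Theta>"
    and stationary: "stationary_seq M \<Theta> \<xi>"
    and ergodic: "ergodic_seq M \<Theta> \<xi>"
    and eta: "\<eta> \<in> \<Theta> \<rightarrow>\<^sub>M prob_algebra rvec_space"
    and P: "P = annealed \<eta> (seq_law M \<Theta> \<xi>)"
    and m0: "AE (s, X) in P. 0 < mean_offspring \<eta> s 0 \<and> mean_offspring \<eta> s 0 < \<infinity>"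
    and log_m0: "integrable P (\<lambda>(s, X). ln (enn2real (mean_offspring \<eta> s 0)))"
    and log_m0_pos: "(\<integral> (s, X). ln (enn2real (mean_offspring \<eta> s 0)) \<partial>P) > 0"
    and N_log_N: "(\<integral>\<^sup>+ (s, X). of_nat (offspring X []) / mean_offspring \<eta> s 0
          * ennreal (log_plus (real (offspring X []))) \<partial>P) < \<infinity>"
    and mu0: "AE (s, X) in P. integrable (quenched \<eta> s) (displacement_sum 0)"
    and sigma0_pos: "0 < (\<integral>\<^sup>+ (s, X). var_displacement \<eta> s 0 \<partial>P)"
    and sigma0_fin: "(\<integral>\<^sup>+ (s, X). var_displacement \<eta> s 0 \<partial>P) < \<infinity>"
  shows "AE (s, X) in P.
    (\<lambda>n. enn2real (quenched_intensity \<eta> s n {..scaling \<eta> s n * x + centering \<eta> s n})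
        / enn2real (quenched_intensity \<eta> s n UNIV))
      \<longlonglongrightarrow> cdf std_normal_distribution x"
proof -
  define \<tau> where "\<tau> = seq_law M \<Theta> \<xi>"
  have sets_\<tau>[measurable_cong]: "sets \<tau> = sets (\<Pi>\<^sub>M n\<in>UNIV. \<Theta>)" by (simp add: \<tau>_def sets_seq_law)
  have space_\<tau>: "space \<tau> = space (\<Pi>\<^sub>M n\<in>UNIV. \<Theta>)" by (rule sets_eq_imp_space_eq[OF sets_\<tau>])
  interpret \<tau>: prob_space \<tau>
    unfolding \<tau>_def by (rule prob_space_seq_law[OF M xi stationary])
  have P: "P = annealed \<eta> \<tau>" by (simp add: P \<tau>_def)
  note annealed = eta \<tau>.prob_space_axioms sets_\<tau>
  have comp[measurable]: "(\<lambda>s. s 0) \<in> \<tau> \<rightarrow>\<^sub>M \<Theta>" by measurable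
  define m where "m \<theta> = rvec_mean (\<eta> \<theta>)" for \<theta>
  define V where "V K \<theta> = rvec_tail_variance K (\<eta> \<theta>)" for K \<theta>
  have [measurable]: "m \<in> borel_measurable \<Theta>" "V K \<in> borel_measurable \<Theta>" for K
    unfolding m_def[abs_def] V_def[abs_def] using rvec_mean_measurable[OF eta] rvec_tail_variance_measurable[OF eta] by auto
  have V_le: "V K \<theta> \<le> V (- 1) \<theta>" for K \<theta> unfolding V_def by (rule rvec_tail_variance_le)
  note eqs = mean_offspring_eq[OF eta] var_displacement_eq[OF eta]

  have space_P: "fst p \<in> space (\<Pi>\<^sub>M n\<in>UNIV. \<Theta>)" if "p \<in> space P" for p
    using measurable_space[OF distr_annealed_fst(1)[OF annealed]] that P space_\<tau> by auto
  \<comment> \<open>The identities in \<open>eqs\<close> hold for environments in the space of the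
    product, hence the appeal to \<open>AE_space\<close>.\<close>
  have "AE (s, X) in annealed \<eta> \<tau>. 0 < m (s 0) \<and> m (s 0) < \<infinity>"
    using m0 AE_space[of P] unfolding P[symmetric]
    by eventually_elim (use space_P in \<open>force simp: eqs m_def\<close>)
  then have mean: "AE s in \<tau>. 0 < m (s 0) \<and> m (s 0) < \<infinity>"
    by (subst (asm) AE_annealed_iff[OF annealed]) measurable
  have "(\<integral>\<^sup>+ (s, X). var_displacement \<eta> s 0 \<partial>P) = (\<integral>\<^sup>+ (s, X). V (- 1) (s 0) \<partial>P)"
    by (intro nn_integral_cong) (use space_P in \<open>force simp: eqs V_def\<close>)
  also have "\<dots> = (\<integral>\<^sup>+ s. V (- 1) (s 0) \<partial>\<tau>)"
    unfolding P by (rule nn_integral_annealed[OF annealed]) measurable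
  finally have V_int: "0 < (\<integral>\<^sup>+ s. V (- 1) (s 0) \<partial>\<tau>)" "(\<integral>\<^sup>+ s. V (- 1) (s 0) \<partial>\<tau>) < \<infinity>"
    using sigma0_pos sigma0_fin by simp_all
  have V_fin: "AE s in \<tau>. V (- 1) (s 0) < \<infinity>"
    using V_int(2) nn_integral_PInf_AE[of "\<lambda>s. V (- 1) (s 0)" \<tau>] by (simp add: less_top)
  \<comment> \<open>The variances are extended reals, while the ergodic argument takes a real
    function. Almost sure finiteness of \<open>V (- 1) (s 0)\<close>, which dominates every
    \<open>V K (s 0)\<close>, makes the conversion harmless.\<close>
  have V_real: "integrable \<tau> (\<lambda>s. enn2real (V K (s 0))) \<and>
      (\<integral>s. enn2real (V K (s 0)) \<partial>\<tau>) = enn2real (\<integral>\<^sup>+ s. V K (s 0) \<partial>\<tau>)" for K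
  proof -
    have eq: "(\<integral>\<^sup>+ s. ennreal (enn2real (V K (s 0))) \<partial>\<tau>) = (\<integral>\<^sup>+ s. V K (s 0) \<partial>\<tau>)"
    proof (rule nn_integral_cong_AE)
      show "AE s in \<tau>. ennreal (enn2real (V K (s 0))) = V K (s 0)"
        using V_fin by eventually_elim (simp add: le_less_trans[OF V_le])
    qed
    moreover have "(\<integral>\<^sup>+ s. V K (s 0) \<partial>\<tau>) \<le> (\<integral>\<^sup>+ s. V (- 1) (s 0) \<partial>\<tau>)"
      by (intro nn_integral_mono V_le)
    ultimately have "integrable \<tau> (\<lambda>s. enn2real (V K (s 0)))"
      using V_int(2) by (intro integrableI_nonneg) (auto intro: le_less_trans)
    then show ?thesis by (simp add: integral_eq_nn_integral eq)
  qed
  have V_lim: "(\<lambda>K::nat. \<integral>\<^sup>+ s. V K (s 0) \<partial>\<tau>) \<longlonglongrightarrow> (\<integral>\<^sup>+ s. 0 \<partial>\<tau>)"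
  proof (rule nn_integral_dominated_convergence[where w = "\<lambda>s. V (- 1) (s 0)"])
    show "AE s in \<tau>. (\<lambda>K::nat. V K (s 0)) \<longlonglongrightarrow> 0"
      using V_fin by eventually_elim (simp add: V_def rvec_tail_variance_tendsto_0)
  qed (use V_le V_int in auto)

  define v where "v = (\<integral>s. enn2real (V (- 1) (s 0)) \<partial>\<tau>)"
  have v: "0 < v" unfolding v_def using V_int V_real[of "- 1"] by (simp add: enn2real_positive_iff)
  \<comment> \<open>The summand has mean \<open>- v / 2\<close>; any rate strictly between 0 and
    \<open>v\<close> would serve equally well.\<close>
  have "AE s in \<tau>. \<exists>C. \<forall>n. (\<Sum>k<n. v / 2 - enn2real (V (- 1) (s k))) \<le> C"
    using V_real[of "- 1"] v unfolding \<tau>_def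
    by (intro ergodic_sums_bounded_above[OF M xi stationary ergodic])
      (auto simp: \<tau>_def[symmetric] v_def \<tau>.prob_space)
  then have growth: "AE s in \<tau>. \<exists>C. \<forall>n. v / 2 * real n - C \<le> (\<Sum>k<n. enn2real (V (- 1) (s k)))"
    by eventually_elim (auto simp: sum_subtractf algebra_simps)
  \<comment> \<open>For large \<open>K\<close> the mean of the truncated variance falls below
    \<open>1 / real (Suc j)\<close>, so the difference has negative mean. Countably many thresholds
    let the exceptional null sets be united before \<open>\<delta>\<close> is given.\<close>
  have "AE s in \<tau>. \<exists>(K::nat) D. \<forall>n. (\<Sum>k<n. enn2real (V K (s k)) - 1 / real (Suc j)) \<le> D" for j
  proof -
    have "\<forall>\<^sub>F K::nat in sequentially. (\<integral>\<^sup>+ s. V K (s 0) \<partial>\<tau>) < ennreal (1 / real (Suc j))"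
      using V_lim by (intro order_tendstoD(2)) auto
    then obtain K :: nat where K: "(\<integral>\<^sup>+ s. V K (s 0) \<partial>\<tau>) < ennreal (1 / real (Suc j))"
      by (auto simp: eventually_sequentially)
    then have "enn2real (\<integral>\<^sup>+ s. V K (s 0) \<partial>\<tau>) < 1 / real (Suc j)"
      by (subst enn2real_less_iff) (auto intro: less_trans)
    then have "AE s in \<tau>. \<exists>D. \<forall>n. (\<Sum>k<n. enn2real (V K (s k)) - 1 / real (Suc j)) \<le> D"
      using V_real[of K] unfolding \<tau>_def
      by (intro ergodic_sums_bounded_above[OF M xi stationary ergodic])
        (auto simp: \<tau>_def[symmetric] \<tau>.prob_space)
    then show ?thesis by eventually_elim blast
  qed
  then have tails: "AE s in \<tau>. \<forall>j. \<exists>(K::nat) D. \<forall>n. (\<Sum>k<n. enn2real (V K (s k)) - 1 / real (Suc j)) \<le> D"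
    by (simp add: AE_all_countable)
  have "AE s in \<tau>. 0 < m (s 0) \<and> m (s 0) < \<infinity> \<and> V (- 1) (s 0) < \<infinity>"
    using mean V_fin by eventually_elim simp
  then have good: "AE s in \<tau>. \<forall>k. 0 < m (s k) \<and> m (s k) < \<infinity> \<and> V (- 1) (s k) < \<infinity>"
    unfolding \<tau>_def by (rule AE_stationary[OF M xi stationary])
  from AE_space good growth tails
  have "AE s in \<tau>. (\<lambda>n. enn2real (quenched_intensity \<eta> s n {..scaling \<eta> s n * x + centering \<eta> s n})
        / enn2real (quenched_intensity \<eta> s n UNIV)) \<longlonglongrightarrow> cdf std_normal_distribution x"
  proof eventually_elim
    case (elim s)
    obtain C where C: "\<And>n. v / 2 * real n - C \<le> (\<Sum>k<n. enn2real (V (- 1) (s k)))"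
      using elim by blast
    show ?case
    proof (rule quenched_clt[OF eta])
      show "s \<in> space (\<Pi>\<^sub>M n\<in>UNIV. \<Theta>)" using elim space_\<tau> by simp
      show "0 < v / 2" using v by simp
      show "v / 2 * real n - C \<le> (\<Sum>k<n. enn2real (rvec_variance (\<eta> (s k))))" for n
        using C by (simp add: V_def)
      fix \<delta> :: real assume "0 < \<delta>"
      then obtain j where j: "1 / real (Suc j) < \<delta>" using nat_approx_posE by blast
      obtain K :: nat and D where "\<And>n. (\<Sum>k<n. enn2real (V K (s k)) - 1 / real (Suc j)) \<le> D"
        using elim by blast
      then have KD: "(\<Sum>k<n. enn2real (V K (s k))) \<le> 1 / real (Suc j) * real n + D" for n
        by (simp add: sum_subtractf algebra_simps)
      have "(\<Sum>k<n. enn2real (V K (s k))) \<le> \<delta> * real n + D" for n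
        using KD[of n] mult_right_mono[OF less_imp_le[OF j], of "real n"] by simp
      then show "\<exists>K D. \<forall>n. (\<Sum>k<n. enn2real (rvec_tail_variance K (\<eta> (s k)))) \<le> \<delta> * real n + D"
        unfolding V_def by blast
    qed (use elim in \<open>auto simp: m_def V_def\<close>)
  qed
  then show ?thesis unfolding P by (rule AE_annealedI[OF annealed])
qed

end
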